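(* For every Turing degree $\mathbf{d}$, the following are equivalent: (1) every $2$--cohesive set has Turing degree $\ge \mathbf{d}$; (2) $\mathbf{d} \le \mathbf{0}'$.
   Context: A $2$--coloring of $[\omega]^2$ (the $2$--element subsets of $\omega$) is a function $\mathcal{C}:[\omega]^2\to\{0,1\}$; it is computably enumerable if one of its color classes is c.e. under a standard coding. $A$ is almost homogeneous for $\mathcal{C}$ if there is a finite $F$ such that $\mathcal{C}$ is constant on $[A\setminus F]^2$. An infinite set $A$ is $2$--cohesive if it is almost homogeneous for every computably enumerable $2$--coloring of $[\omega]^2$. $\mathbf{0}'$ is the degree of the halting set. *)

theory Defs
  imports "HOL-Library.Nat_Bijection" "HOL-Library.Ramsey"
begin

text \<open>
  Kleene's partial recursive functions relative to a set of natural numbers. All programs are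
  unary; several arguments are passed through the Cantor pairing function
  \<^const>\<open>prod_encode\<close>.
\<close>

datatype program =
    Zero
  | Successor
  | First
  | Second
  | Query
  | Pairing program program
  | Compose program program
  | PrimRec program program
  | Minimize program

text \<open>\<open>computes B p x y\<close>: on input \<open>x\<close>, program \<open>p\<close> with \<open>Query\<close> answered by \<open>B\<close> halts with output \<open>y\<close>.\<close>

inductive computes :: "nat set \<Rightarrow> program \<Rightarrow> nat \<Rightarrow> nat \<Rightarrow> bool" for B :: "nat set" where
  zero: "computes B Zero x 0"
| successor: "computes B Successor x (Suc x)"
| first: "computes B First (prod_encode (x, y)) x"
| second: "computes B Second (prod_encode (x, y)) y"
| query: "computes B Query x (of_bool (x \<in> B))"
| pairing: "computes B p x y \<Longrightarrow> computes B q x z \<Longrightarrow>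
    computes B (Pairing p q) x (prod_encode (y, z))"
| compose: "computes B q x y \<Longrightarrow> computes B p y z \<Longrightarrow> computes B (Compose p q) x z"
| rec_0: "computes B p x y \<Longrightarrow> computes B (PrimRec p q) (prod_encode (x, 0)) y"
| rec_Suc: "computes B (PrimRec p q) (prod_encode (x, n)) y \<Longrightarrow>
    computes B q (prod_encode (x, prod_encode (n, y))) z \<Longrightarrow>
    computes B (PrimRec p q) (prod_encode (x, Suc n)) z"
| minimize: "computes B p (prod_encode (x, n)) 0 \<Longrightarrow>
    (\<forall>m<n. \<exists>y>0. computes B p (prod_encode (x, m)) y) \<Longrightarrow>
    computes B (Minimize p) x n"

inductive_cases computes_elims:
  "computes B Zero x z"
  "computes B Successor x z"
  "computes B First x z"
  "computes B Second x z"
  "computes B Query x z"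
  "computes B (Pairing p q) x z"
  "computes B (Compose p q) x z"
  "computes B (Minimize p) x z"

inductive_cases computes_rec_0_elim: "computes B (PrimRec p q) (prod_encode (x, 0)) z"
inductive_cases computes_rec_Suc_elim: "computes B (PrimRec p q) (prod_encode (x, Suc n)) z"

lemma computes_deterministic:
  assumes "computes B p x y" and "computes B p x z"
  shows "y = z"
  using assms
proof (induction arbitrary: z rule: computes.induct)
  case (minimize p x n)
  from minimize.prems obtain
    z0: "computes B p (prod_encode (x, z)) 0" and
    zlt: "\<forall>m<z. \<exists>y>0. computes B p (prod_encode (x, m)) y"
    by (auto elim: computes_elims)
  show ?case
  proof (rule linorder_cases [of n z])
    assume "n < z"
    then obtain y where "y > 0" "computes B p (prod_encode (x, n)) y" using zlt by blast
    then show ?thesis using minimize.IH(1) by blast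
  next
    assume "z < n"
    then show ?thesis using minimize.IH(2) z0 by blast
  qed
next
  case (rec_0 p x y q)
  from rec_0.prems have "computes B p x z" by (rule computes_rec_0_elim) auto
  then show ?case by (rule rec_0.IH)
next
  case (rec_Suc p q x n y w)
  from rec_Suc.prems obtain v where
    "computes B (PrimRec p q) (prod_encode (x, n)) v" and
    v: "computes B q (prod_encode (x, prod_encode (n, v))) z"
    by (rule computes_rec_Suc_elim) auto
  then have "y = v" by (intro rec_Suc.IH(1))
  with v show ?case by (intro rec_Suc.IH(2)) simp
next
  case (compose q x y p w)
  from compose.prems obtain v where "computes B q x v" and v: "computes B p v z"
    by (rule computes_elims)
  then have "y = v" by (intro compose.IH(1))
  with v show ?case by (intro compose.IH(2)) simp
next
  case (pairing p x y q w)
  from pairing.prems obtain u v where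
    "z = prod_encode (u, v)" "computes B p x u" "computes B q x v"
    by (rule computes_elims)
  then show ?case using pairing.IH by simp
qed (auto elim: computes_elims)

definition computably_enumerable :: "nat set \<Rightarrow> bool" where
  "computably_enumerable W \<longleftrightarrow> (\<exists>p. W = {x. \<exists>y. computes {} p x y})"

definition turing_reducible :: "nat set \<Rightarrow> nat set \<Rightarrow> bool" where
  "turing_reducible A B \<longleftrightarrow> (\<exists>p. \<forall>x. computes B p x (of_bool (x \<in> A)))"

definition turing_equivalent :: "nat set \<Rightarrow> nat set \<Rightarrow> bool" where
  "turing_equivalent A B \<longleftrightarrow> turing_reducible A B \<and> turing_reducible B A"

primrec replace_query :: "program \<Rightarrow> program \<Rightarrow> program" where
  "replace_query r Zero = Zero"
| "replace_query r Successor = Successor"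
| "replace_query r First = First"
| "replace_query r Second = Second"
| "replace_query r Query = r"
| "replace_query r (Pairing p q) = Pairing (replace_query r p) (replace_query r q)"
| "replace_query r (Compose p q) = Compose (replace_query r p) (replace_query r q)"
| "replace_query r (PrimRec p q) = PrimRec (replace_query r p) (replace_query r q)"
| "replace_query r (Minimize p) = Minimize (replace_query r p)"

lemma computes_replace_query:
  assumes "computes B p x y" and r: "\<And>x. computes C r x (of_bool (x \<in> B))"
  shows "computes C (replace_query r p) x y"
  using assms(1)
proof (induction rule: computes.induct)
  case (query x)
  then show ?case using r by simp
next
  case (minimize p x n)
  then show ?case by (auto intro: computes.minimize)
qed (auto intro: computes.intros)

lemma turing_reducible_refl: "turing_reducible A A"
  unfolding turing_reducible_def by (blast intro: computes.query)

lemma turing_reducible_trans: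
  assumes "turing_reducible A B" and "turing_reducible B C"
  shows "turing_reducible A C"
  using assms unfolding turing_reducible_def by (blast intro: computes_replace_query)

quotient_type turing_degree = "nat set" / turing_equivalent
proof (rule equivpI)
  show "reflp turing_equivalent"
    by (simp add: reflp_def turing_equivalent_def turing_reducible_refl)
  show "symp turing_equivalent"
    by (simp add: symp_def turing_equivalent_def)
  show "transp turing_equivalent"
    unfolding transp_def turing_equivalent_def by (blast intro: turing_reducible_trans)
qed

lift_definition degree_of :: "nat set \<Rightarrow> turing_degree" is "\<lambda>A. A" .

instantiation turing_degree :: order
begin

lift_definition less_eq_turing_degree :: "turing_degree \<Rightarrow> turing_degree \<Rightarrow> bool"
  is turing_reducible
  unfolding turing_equivalent_def by (blast intro: turing_reducible_trans)

definition less_turing_degree :: "turing_degree \<Rightarrow> turing_degree \<Rightarrow> bool" where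
  "less_turing_degree a b \<longleftrightarrow> a \<le> b \<and> \<not> b \<le> a"

instance
proof
  fix a b c :: turing_degree
  show "a < b \<longleftrightarrow> a \<le> b \<and> \<not> b \<le> a" by (rule less_turing_degree_def)
  show "a \<le> a" by transfer (rule turing_reducible_refl)
  show "a \<le> b \<Longrightarrow> b \<le> c \<Longrightarrow> a \<le> c" by transfer (rule turing_reducible_trans)
  show "a \<le> b \<Longrightarrow> b \<le> a \<Longrightarrow> a = b" by transfer (simp add: turing_equivalent_def)
qed

end

lemma degree_of_le_iff: "degree_of A \<le> degree_of B \<longleftrightarrow> turing_reducible A B"
  by transfer (rule refl)

primrec program_code :: "program \<Rightarrow> nat" where
  "program_code Zero = prod_encode (0, 0)"
| "program_code Successor = prod_encode (1, 0)"
| "program_code First = prod_encode (2, 0)"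
| "program_code Second = prod_encode (3, 0)"
| "program_code Query = prod_encode (4, 0)"
| "program_code (Pairing p q) = prod_encode (5, prod_encode (program_code p, program_code q))"
| "program_code (Compose p q) = prod_encode (6, prod_encode (program_code p, program_code q))"
| "program_code (PrimRec p q) = prod_encode (7, prod_encode (program_code p, program_code q))"
| "program_code (Minimize p) = prod_encode (8, program_code p)"

lemma program_code_inject: "program_code p = program_code q \<longleftrightarrow> p = q"
proof (induction p arbitrary: q)
  case Zero then show ?case by (cases q) auto
next
  case Successor then show ?case by (cases q) auto
next
  case First then show ?case by (cases q) auto
next
  case Second then show ?case by (cases q) auto
next
  case Query then show ?case by (cases q) auto
next
  case (Pairing p1 p2) then show ?case by (cases q) auto
next
  case (Compose p1 p2) then show ?case by (cases q) auto
next
  case (PrimRec p1 p2) then show ?case by (cases q) auto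
next
  case (Minimize p) then show ?case by (cases q) auto
qed

definition halting_set :: "nat set" where
  "halting_set = {prod_encode (program_code p, x) | p x. \<exists>y. computes {} p x y}"

definition zero_jump :: turing_degree where
  "zero_jump = degree_of halting_set"

text \<open>Only the values of a coloring on \<^term>\<open>[UNIV :: nat set]\<^bsup>2\<^esup>\<close> matter.\<close>

definition two_coloring :: "(nat set \<Rightarrow> nat) \<Rightarrow> bool" where
  "two_coloring C \<longleftrightarrow> C \<in> [UNIV]\<^bsup>2\<^esup> \<rightarrow> {0, 1}"

text \<open>A pair \<open>{x, y}\<close> with \<open>x < y\<close> is coded by \<open>prod_encode (x, y)\<close>.\<close>

definition color_class :: "(nat set \<Rightarrow> nat) \<Rightarrow> nat \<Rightarrow> nat set" where
  "color_class C i = {prod_encode (x, y) | x y. x < y \<and> C {x, y} = i}"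

definition ce_coloring :: "(nat set \<Rightarrow> nat) \<Rightarrow> bool" where
  "ce_coloring C \<longleftrightarrow> two_coloring C \<and> (\<exists>i\<in>{0, 1}. computably_enumerable (color_class C i))"

definition almost_homogeneous :: "nat set \<Rightarrow> (nat set \<Rightarrow> nat) \<Rightarrow> bool" where
  "almost_homogeneous A C \<longleftrightarrow> (\<exists>F. finite F \<and> (\<exists>i. \<forall>s\<in>[A - F]\<^bsup>2\<^esup>. C s = i))"

definition two_cohesive :: "nat set \<Rightarrow> bool" where
  "two_cohesive A \<longleftrightarrow> infinite A \<and> (\<forall>C. ce_coloring C \<longrightarrow> almost_homogeneous A C)"

end

theory Submission
  imports Defs
begin

text \<open>
  Colour \<open>{x < y}\<close> with 1 if some \<open>k < x\<close> lies in the halting set but has no witness below \<open>y\<close>. For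
  fixed \<open>x\<close> this colour is eventually 0, so a 2-cohesive set is, up to finitely many elements,
  homogeneous for colour 0, and its elements then give witness bounds for the halting set.

  Conversely, if \<open>D\<close> is not computable from the halting set \<open>Z\<close>, then \<open>D\<close> or its complement is not c.e.
  in \<open>Z\<close>, and it suffices to find a 2-cohesive \<open>A\<close> such that this set is not c.e. in the join of \<open>Z\<close>
  and \<open>A\<close>. Such an \<open>A\<close> is generic for Mathias forcing with reservoirs \<open>S\<close> that have this property;
  a reservoir is made homogeneous for the next coloring by Seetapun's theorem, proved for
  c.e. avoidance. In all forcing arguments the set of those \<open>n\<close> that an extension can
  force into the enumerated set is c.e. in the reservoir and hence differs from \<open>D\<close>; a witness of the
  difference is then decided in the direction opposite to \<open>D\<close>.

  For Seetapun's theorem one builds a homogeneous set of each colour at once. Whether \<open>n\<close> can be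
  forced is asked for all splittings of the reservoir into two parts, which is \<open>\<Sigma>\<^sub>1\<close> by
  compactness. If yes, the splitting by limit colours applies. If no, the splittings that witness this
  form an effectively closed class, and one of its members again avoids \<open>D\<close>.
\<close>

section \<open>Computable functions and decidable predicates\<close>

definition pfst :: "nat \<Rightarrow> nat" where "pfst z = fst (prod_decode z)"
definition psnd :: "nat \<Rightarrow> nat" where "psnd z = snd (prod_decode z)"

lemma pfst_encode [simp]: "pfst (prod_encode (x, y)) = x"
  and psnd_encode [simp]: "psnd (prod_encode (x, y)) = y"
  and encode_pfst_psnd [simp]: "prod_encode (pfst z, psnd z) = z"
  by (simp_all add: pfst_def psnd_def)

lemma pfst_le: "pfst z \<le> z" and psnd_le: "psnd z \<le> z"
  using le_prod_encode_1[of "pfst z" "psnd z"] le_prod_encode_2[of "psnd z" "pfst z"] by simp_all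

definition computable :: "nat set \<Rightarrow> (nat \<Rightarrow> nat) \<Rightarrow> bool" where
  "computable B f \<longleftrightarrow> (\<exists>p. \<forall>x. computes B p x (f x))"

definition decidable :: "nat set \<Rightarrow> (nat \<Rightarrow> bool) \<Rightarrow> bool" where
  "decidable B P \<longleftrightarrow> computable B (\<lambda>x. of_bool (P x))"

lemma turing_reducible_iff_decidable: "turing_reducible A B \<longleftrightarrow> decidable B (\<lambda>x. x \<in> A)"
  by (simp add: turing_reducible_def decidable_def computable_def)

lemma decidable_reduce:
  assumes "decidable B P" "turing_reducible B C"
  shows "decidable C P"
  using turing_reducible_trans[of "{x. P x}" B C] assms by (simp add: turing_reducible_iff_decidable)

section \<open>Closure properties of computable functions\<close>

lemma computable_const: "computable B (\<lambda>_. c)"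
proof (induction c)
  case 0 show ?case unfolding computable_def by (blast intro: computes.zero)
next
  case (Suc c) then show ?case
    unfolding computable_def by (blast intro: computes.successor computes.compose)
qed

lemma computable_pair:
  "computable B f \<Longrightarrow> computable B g \<Longrightarrow> computable B (\<lambda>x. prod_encode (f x, g x))"
  unfolding computable_def by (blast intro: computes.pairing)

lemma computable_comp: "computable B f \<Longrightarrow> computable B g \<Longrightarrow> computable B (\<lambda>x. f (g x))"
  unfolding computable_def by (blast intro: computes.compose)

lemma computes_First: "computes B First x (pfst x)"
  using computes.first[of B "pfst x" "psnd x"] by simp

lemma computes_Second: "computes B Second x (psnd x)"
  using computes.second[of B "pfst x" "psnd x"] by simp

lemma computable_pfst: "computable B f \<Longrightarrow> computable B (\<lambda>x. pfst (f x))"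
  by (rule computable_comp[of B pfst]) (auto simp: computable_def intro: computes_First)

lemma computable_psnd: "computable B f \<Longrightarrow> computable B (\<lambda>x. psnd (f x))"
  by (rule computable_comp[of B psnd]) (auto simp: computable_def intro: computes_Second)

lemma computable_Suc: "computable B f \<Longrightarrow> computable B (\<lambda>x. Suc (f x))"
  by (rule computable_comp[of B Suc]) (auto simp: computable_def intro: computes.successor)

text \<open>None of the basic programs is the identity; pairing the two projections yields
  it.\<close>

lemma computable_id: "computable B (\<lambda>x. x)"
  using computable_pair[of B pfst psnd] computes_First[of B] computes_Second[of B]
  by (auto simp: computable_def)

text \<open>\<open>PrimRec\<close> recurses on the second component of its input and carries the
  first along as a parameter, so it is run on the pair of \<open>x\<close> and
  \<open>h x\<close>.\<close>

lemma computable_rec_nat: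
  assumes f: "computable B f"
    and g: "computable B (\<lambda>z. g (pfst z) (pfst (psnd z)) (psnd (psnd z)))"
    and h: "computable B h"
  shows "computable B (\<lambda>x. rec_nat (f x) (\<lambda>n y. g x n y) (h x))"
proof -
  obtain p q where p: "\<And>x. computes B p x (f x)"
    and q: "\<And>z. computes B q z (g (pfst z) (pfst (psnd z)) (psnd (psnd z)))"
    using f g unfolding computable_def by auto
  have "computes B (PrimRec p q) (prod_encode (x, n)) (rec_nat (f x) (\<lambda>n y. g x n y) n)" for x n
  proof (induction n)
    case 0 show ?case using p by (simp add: computes.rec_0)
  next
    case (Suc n)
    then show ?case using q[of "prod_encode (x, prod_encode (n, rec_nat (f x) (g x) n))"]
      by (auto intro: computes.rec_Suc)
  qed
  from this[of "pfst z" "psnd z" for z]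
  have "computes B (PrimRec p q) z (rec_nat (f (pfst z)) (\<lambda>n y. g (pfst z) n y) (psnd z))" for z
    by simp
  then have "computable B (\<lambda>z. rec_nat (f (pfst z)) (\<lambda>n y. g (pfst z) n y) (psnd z))"
    unfolding computable_def by blast
  from computable_comp[OF this computable_pair[OF computable_id h]] show ?thesis by simp
qed

lemmas computable_basic = computable_const computable_id computable_pfst computable_psnd
  computable_pair computable_Suc

lemma computable_add:
  assumes "computable B f" "computable B g"
  shows "computable B (\<lambda>x. f x + g x)"
proof -
  have "rec_nat a (\<lambda>n y. Suc y) b = a + b" for a b :: nat by (induction b) auto
  moreover have "computable B (\<lambda>x. rec_nat (f x) (\<lambda>n y. Suc y) (g x))"
    by (intro computable_rec_nat assms computable_basic)
  ultimately show ?thesis by simp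
qed

lemma computable_mult:
  assumes "computable B f" "computable B g"
  shows "computable B (\<lambda>x. f x * g x)"
proof -
  have "rec_nat 0 (\<lambda>n y. y + a) b = a * b" for a b :: nat by (induction b) auto
  moreover have "computable B (\<lambda>x. rec_nat 0 (\<lambda>n y. y + f x) (g x))"
    by (intro computable_rec_nat assms computable_basic computable_add computable_comp[OF assms(1)])
  ultimately show ?thesis by simp
qed

lemma computable_diff:
  assumes "computable B f" "computable B g"
  shows "computable B (\<lambda>x. f x - g x)"
proof -
  have pred: "rec_nat 0 (\<lambda>n y. n) b = b - 1" for b :: nat by (induction b) auto
  have "rec_nat a (\<lambda>n y. rec_nat 0 (\<lambda>n y. n) y) b = a - b" for a b :: nat
    by (induction b) (auto simp: pred)
  moreover have "computable B (\<lambda>x. rec_nat (f x) (\<lambda>n y. rec_nat 0 (\<lambda>n y. n) y) (g x))"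
    by (intro computable_rec_nat assms computable_basic)
  ultimately show ?thesis by simp
qed

lemma computable_power2:
  assumes "computable B f"
  shows "computable B (\<lambda>x. 2 ^ f x)"
proof -
  have "rec_nat (1::nat) (\<lambda>n y. y + y) b = 2 ^ b" for b by (induction b) auto
  moreover have "computable B (\<lambda>x. rec_nat 1 (\<lambda>n y. y + y) (f x))"
    by (intro computable_rec_nat assms computable_basic computable_add)
  ultimately show ?thesis by simp
qed

section \<open>Closure properties of decidable predicates\<close>

lemma decidable_comp: "decidable B P \<Longrightarrow> computable B f \<Longrightarrow> decidable B (\<lambda>x. P (f x))"
  unfolding decidable_def by (rule computable_comp)

lemma decidable_const: "decidable B (\<lambda>_. P)"
  unfolding decidable_def by (rule computable_const)

lemma decidable_oracle: "computable B f \<Longrightarrow> decidable B (\<lambda>x. f x \<in> B)"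
  by (rule decidable_comp[of B "\<lambda>x. x \<in> B"])
    (simp_all only: decidable_def computable_def, blast intro: computes.query)

lemma decidable_reducible:
  "turing_reducible A B \<Longrightarrow> computable B f \<Longrightarrow> decidable B (\<lambda>x. f x \<in> A)"
  unfolding turing_reducible_iff_decidable by (rule decidable_comp)

lemma decidable_not:
  assumes "decidable B P"
  shows "decidable B (\<lambda>x. \<not> P x)"
proof -
  have *: "(1::nat) - of_bool (P x) = of_bool (\<not> P x)" for x by simp
  have "computable B (\<lambda>x. 1 - of_bool (P x))"
    using assms unfolding decidable_def by (intro computable_diff computable_const)
  then show ?thesis unfolding decidable_def * .
qed

lemma decidable_conj:
  assumes "decidable B P" "decidable B Q"
  shows "decidable B (\<lambda>x. P x \<and> Q x)"
  using computable_mult[of B "\<lambda>x. of_bool (P x)" "\<lambda>x. of_bool (Q x)"] assms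
  unfolding decidable_def by (simp add: of_bool_conj)

lemma decidable_disj:
  assumes "decidable B P" "decidable B Q"
  shows "decidable B (\<lambda>x. P x \<or> Q x)"
proof -
  have "decidable B (\<lambda>x. \<not> (\<not> P x \<and> \<not> Q x))"
    by (intro decidable_not decidable_conj assms)
  then show ?thesis by simp
qed

lemma decidable_imp: "decidable B P \<Longrightarrow> decidable B Q \<Longrightarrow> decidable B (\<lambda>x. P x \<longrightarrow> Q x)"
  unfolding imp_conv_disj by (intro decidable_disj decidable_not)

lemma decidable_iff: "decidable B P \<Longrightarrow> decidable B Q \<Longrightarrow> decidable B (\<lambda>x. P x \<longleftrightarrow> Q x)"
  unfolding iff_conv_conj_imp by (intro decidable_conj decidable_imp)

lemma decidable_less:
  assumes "computable B f" "computable B g"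
  shows "decidable B (\<lambda>x. f x < g x)"
proof -
  \<comment> \<open>Subtraction is truncated at 0, so \<open>1 - (1 - n)\<close> is 0 for
    \<open>n = 0\<close> and 1 otherwise.\<close>
  have *: "(1::nat) - (1 - (g x - f x)) = of_bool (f x < g x)" for x by auto
  have "computable B (\<lambda>x. 1 - (1 - (g x - f x)))"
    by (intro computable_diff computable_const assms)
  then show ?thesis unfolding decidable_def * .
qed

lemma decidable_le: "computable B f \<Longrightarrow> computable B g \<Longrightarrow> decidable B (\<lambda>x. f x \<le> g x)"
  unfolding not_less[symmetric] by (intro decidable_not decidable_less)

lemma decidable_eq: "computable B f \<Longrightarrow> computable B g \<Longrightarrow> decidable B (\<lambda>x. f x = g x)"
  unfolding eq_iff[of "f _"] by (intro decidable_conj decidable_le)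

lemma decidable_ex_less:
  assumes P: "decidable B (\<lambda>z. P (pfst z) (psnd z))" and f: "computable B f"
  shows "decidable B (\<lambda>x. \<exists>y<f x. P x y)"
proof -
  \<comment> \<open>The recursion accumulates a disjunction, which on bits is
    \<open>1 - (1 - v) * (1 - w)\<close>.\<close>
  have *: "rec_nat 0 (\<lambda>n v. 1 - (1 - v :: nat) * (1 - of_bool (P x n))) k = of_bool (\<exists>y<k. P x y)" for x k
    by (induction k) (auto simp: less_Suc_eq)
  have "computable B (\<lambda>z. of_bool (P (pfst z) (pfst (psnd z))))"
    using computable_comp[OF P[unfolded decidable_def]
        computable_pair[OF computable_pfst[OF computable_id] computable_pfst[OF computable_psnd[OF computable_id]]]]
    by simp
  then have "computable B (\<lambda>x. rec_nat 0 (\<lambda>n v. 1 - (1 - v) * (1 - of_bool (P x n))) (f x))"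
    by (intro computable_rec_nat f computable_basic computable_diff computable_mult)
  then show ?thesis unfolding decidable_def * .
qed

lemma decidable_all_less:
  assumes P: "decidable B (\<lambda>z. P (pfst z) (psnd z))" and f: "computable B f"
  shows "decidable B (\<lambda>x. \<forall>y<f x. P x y)"
proof -
  have "decidable B (\<lambda>x. \<not> (\<exists>y<f x. \<not> P x y))"
    by (intro decidable_not decidable_ex_less P f)
  then show ?thesis by simp
qed

lemma decidable_ex_le:
  assumes P: "decidable B (\<lambda>z. P (pfst z) (psnd z))" and f: "computable B f"
  shows "decidable B (\<lambda>x. \<exists>y\<le>f x. P x y)"
  unfolding less_Suc_eq_le[symmetric] by (intro decidable_ex_less P computable_Suc f)

section \<open>Finite sets coded as numbers\<close>

lemma decidable_set_decode:
  assumes "computable B f" "computable B g"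
  shows "decidable B (\<lambda>x. f x \<in> set_decode (g x))"
proof -
  \<comment> \<open>Membership says that \<open>b div 2 ^ x\<close> is odd. The search for quotient
    and remainder is bounded by \<open>b\<close> and \<open>2 ^ x\<close>.\<close>
  have *: "x \<in> set_decode b \<longleftrightarrow> (\<exists>q\<le>b. \<exists>r<2 ^ x. b = (2 * q + 1) * 2 ^ x + r)" for x b
  proof
    assume "x \<in> set_decode b"
    then have "odd (b div 2 ^ x)" by (simp add: set_decode_def)
    then obtain q where q: "b div 2 ^ x = 2 * q + 1" by (rule oddE)
    then have "b = (2 * q + 1) * 2 ^ x + b mod 2 ^ x" by (metis div_mult_mod_eq)
    moreover have "q \<le> b" using q div_le_dividend[of b "2 ^ x"] by linarith
    moreover have "b mod 2 ^ x < 2 ^ x" by simp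
    ultimately show "\<exists>q\<le>b. \<exists>r<2 ^ x. b = (2 * q + 1) * 2 ^ x + r" by blast
  next
    assume "\<exists>q\<le>b. \<exists>r<2 ^ x. b = (2 * q + 1) * 2 ^ x + r"
    then obtain q r where "r < 2 ^ x" and b: "b = (2 * q + 1) * 2 ^ x + r" by blast
    then have "b div 2 ^ x = 2 * q + 1" using \<open>r < 2 ^ x\<close> by (simp only: b, subst div_mult_self3) auto
    then show "x \<in> set_decode b" by (simp add: set_decode_def)
  qed
  show ?thesis unfolding *
    by (intro decidable_ex_le decidable_ex_less decidable_eq computable_add computable_mult
        computable_power2 computable_basic computable_comp[OF assms(1)] computable_comp[OF assms(2)])
qed

lemma power_le_of_set_decode:
  assumes "x \<in> set_decode b"
  shows "2 ^ x \<le> b"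
proof (rule ccontr)
  assume "\<not> 2 ^ x \<le> b"
  then have "b div 2 ^ x = 0" by simp
  with assms show False by (simp add: set_decode_def)
qed

lemma set_decode_less: "x \<in> set_decode b \<Longrightarrow> x < b"
  using power_le_of_set_decode[of x b] less_exp[of x] by linarith

text \<open>Quantifying over the subsets of \<open>{..<k}\<close> thereby becomes quantifying over
  the numbers below \<open>2 ^ k\<close>, which preserves decidability.\<close>

lemma set_decode_subset_less: "set_decode b \<subseteq> {..<k} \<longleftrightarrow> b < 2 ^ k"
proof
  assume b: "b < 2 ^ k"
  show "set_decode b \<subseteq> {..<k}"
  proof
    fix x assume "x \<in> set_decode b"
    then have "(2::nat) ^ x < 2 ^ k" using power_le_of_set_decode b by (meson le_less_trans)
    then show "x \<in> {..<k}" by simp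
  qed
next
  assume "set_decode b \<subseteq> {..<k}"
  then have "set_encode (set_decode b) \<le> set_encode {..<k}"
    unfolding set_encode_def by (intro sum_mono2) auto
  moreover have "set_encode {..<k} < 2 ^ k"
    by (induction k) (simp_all add: lessThan_Suc)
  ultimately show "b < 2 ^ k" by simp
qed

lemma decidable_ball_decode:
  assumes P: "decidable B (\<lambda>z. P (pfst z) (psnd z))" and f: "computable B f"
  shows "decidable B (\<lambda>x. \<forall>y\<in>set_decode (f x). P x y)"
proof -
  have *: "(\<forall>y\<in>set_decode b. P x y) \<longleftrightarrow> (\<forall>y<b. y \<in> set_decode b \<longrightarrow> P x y)" for x b
    using set_decode_less by blast
  show ?thesis unfolding *
    by (intro decidable_all_less decidable_imp P decidable_set_decode f computable_basic computable_comp[OF f])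
qed

lemma decidable_finite_set:
  assumes "finite F" "computable B f"
  shows "decidable B (\<lambda>x. f x \<in> F)"
  using decidable_set_decode[OF assms(2) computable_const[of B "set_encode F"]] assms(1) by simp

lemmas decidable_intros = decidable_const decidable_conj decidable_disj decidable_not decidable_imp
  decidable_iff decidable_less decidable_le decidable_eq decidable_ex_less decidable_ex_le
  decidable_all_less decidable_ball_decode decidable_set_decode computable_basic computable_add
  computable_power2

section \<open>Relative computable enumerability\<close>

text \<open>A projection of a decidable relation rather than the domain of a program, so that
  enumerability of an explicit set follows from the closure rules for decidability.\<close>

definition ce_in :: "nat set \<Rightarrow> nat set \<Rightarrow> bool" where
  "ce_in B D \<longleftrightarrow> (\<exists>P. decidable B (\<lambda>z. P (pfst z) (psnd z)) \<and> D = {x. \<exists>y. P x y})"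

lemma ce_inI: "decidable B (\<lambda>z. P (pfst z) (psnd z)) \<Longrightarrow> ce_in B {x. \<exists>y. P x y}"
  unfolding ce_in_def by (rule exI[of _ P]) simp

lemma ce_inE:
  assumes "ce_in B D"
  obtains P where "decidable B (\<lambda>z. P (pfst z) (psnd z))" "D = {x. \<exists>y. P x y}"
  using assms unfolding ce_in_def by (elim exE conjE)

lemma ce_in_reduce: "ce_in B D \<Longrightarrow> turing_reducible B C \<Longrightarrow> ce_in C D"
  by (elim ce_inE) (simp only:, rule ce_inI, rule decidable_reduce)

lemma ce_in_reducible: "turing_reducible D B \<Longrightarrow> ce_in B D"
  using ce_inI[of B "\<lambda>x y. x \<in> D", OF decidable_reducible[OF _ computable_pfst[OF computable_id]]]
  by simp

lemma reducible_Compl: "turing_reducible D B \<Longrightarrow> turing_reducible (- D) B"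
  unfolding turing_reducible_iff_decidable Compl_iff by (rule decidable_not)

text \<open>\<open>Minimize\<close> searches for output 0, so \<open>p\<close> decides the negation
  of \<open>P\<close>.\<close>

lemma computes_Minimize:
  assumes p: "\<And>z. computes B p z (of_bool (\<not> P (pfst z) (psnd z)))" and "P x y"
  shows "computes B (Minimize p) x (LEAST y. P x y)"
proof (rule computes.minimize)
  show "computes B p (prod_encode (x, LEAST y. P x y)) 0"
    using p[of "prod_encode (x, LEAST y. P x y)"] LeastI[of "P x", OF \<open>P x y\<close>] by simp
  show "\<forall>m<LEAST y. P x y. \<exists>y>0. computes B p (prod_encode (x, m)) y"
  proof (intro allI impI exI conjI)
    fix m assume "m < (LEAST y. P x y)"
    then have "\<not> P x m" by (rule not_less_Least)
    then show "computes B p (prod_encode (x, m)) 1" using p[of "prod_encode (x, m)"] by simp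
  qed simp
qed

lemma ce_in_imp_computably_enumerable:
  assumes "ce_in {} D"
  shows "computably_enumerable D"
proof -
  obtain P where P: "decidable {} (\<lambda>z. P (pfst z) (psnd z))" and D: "D = {x. \<exists>y. P x y}"
    using assms by (rule ce_inE)
  obtain p where p: "\<And>z. computes {} p z (of_bool (\<not> P (pfst z) (psnd z)))"
    using decidable_not[OF P] unfolding decidable_def computable_def by blast
  have "P x y" if "computes {} (Minimize p) x y" for x y
  proof -
    from that have "computes {} p (prod_encode (x, y)) 0" by (rule computes_elims(8))
    from computes_deterministic[OF p this] show ?thesis by (simp split: if_splits)
  qed
  moreover have "computes {} (Minimize p) x (LEAST y. P x y)" if "P x y" for x y
    using p that by (rule computes_Minimize)
  ultimately have "D = {x. \<exists>y. computes {} (Minimize p) x y}"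
    unfolding D by blast
  then show ?thesis unfolding computably_enumerable_def by blast
qed

text \<open>Post's theorem: search for the first number that witnesses membership or non-membership,
  then check which of the two it witnesses.\<close>

lemma reducible_if_ce_in_both:
  assumes "ce_in B D" "ce_in B (- D)"
  shows "turing_reducible D B"
proof -
  obtain P where P: "decidable B (\<lambda>z. P (pfst z) (psnd z))" and D: "D = {x. \<exists>y. P x y}"
    using assms(1) by (rule ce_inE)
  obtain Q where Q: "decidable B (\<lambda>z. Q (pfst z) (psnd z))" and nD: "- D = {x. \<exists>y. Q x y}"
    using assms(2) by (rule ce_inE)
  obtain p where p: "\<And>z. computes B p z (of_bool (\<not> (P (pfst z) (psnd z) \<or> Q (pfst z) (psnd z))))"
    using decidable_not[OF decidable_disj[OF P Q]] unfolding decidable_def computable_def by blast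
  let ?L = "\<lambda>x. LEAST y. P x y \<or> Q x y"
  have ex: "\<exists>y. P x y \<or> Q x y" for x using D nD by blast
  have "computes B (Minimize p) x (?L x)" for x
  proof -
    obtain y where "P x y \<or> Q x y" using ex by blast
    with p show ?thesis by (rule computes_Minimize[where P = "\<lambda>x y. P x y \<or> Q x y"])
  qed
  then have L: "computable B ?L" unfolding computable_def by blast
  have "x \<in> D \<longleftrightarrow> P x (?L x)" for x
    using LeastI_ex[OF ex[of x]] D nD by blast
  moreover have "decidable B (\<lambda>x. P x (?L x))"
    using decidable_comp[OF P computable_pair[OF computable_id L]] by simp
  ultimately show ?thesis by (simp add: turing_reducible_iff_decidable)
qed

lemma decidable_comp2:
  assumes "decidable B (\<lambda>z. P (pfst z) (psnd z))" "computable B f" "computable B g"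
  shows "decidable B (\<lambda>x. P (f x) (g x))"
  using decidable_comp[OF assms(1) computable_pair[OF assms(2,3)]] by simp

section \<open>Finite derivations\<close>

text \<open>Encodes the claim that the program with code \<open>c\<close> maps \<open>x\<close> to
  \<open>y\<close>.\<close>

definition triple :: "nat \<Rightarrow> nat \<Rightarrow> nat \<Rightarrow> nat" where
  "triple c x y = prod_encode (c, prod_encode (x, y))"

lemma triple_simps [simp]:
  "pfst (triple c x y) = c" "pfst (psnd (triple c x y)) = x" "psnd (psnd (triple c x y)) = y"
  by (simp_all add: triple_def)

lemma triple_eta [simp]: "triple (pfst t) (pfst (psnd t)) (psnd (psnd t)) = t"
  by (simp add: triple_def)

lemma triple_inject [simp]: "triple c x y = triple c' x' y' \<longleftrightarrow> c = c' \<and> x = x' \<and> y = y'"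
  by (simp add: triple_def)

lemma triple_le: "x \<le> triple c x y" "y \<le> triple c x y"
  using pfst_le[of "psnd (triple c x y)"] psnd_le[of "triple c x y"] psnd_le[of "psnd (triple c x y)"]
  by simp_all

text \<open>One disjunct per rule of \<open>computes\<close>, with the premises looked up in
  \<open>M\<close>. Tags 5 to 8 are those of \<open>program_code\<close>. Query answers and the
  predecessor \<open>n\<close> are spelled out so that the predicate can be decided for coded finite
  \<open>M\<close>.\<close>

definition justified :: "nat set \<Rightarrow> nat set \<Rightarrow> nat \<Rightarrow> nat \<Rightarrow> nat \<Rightarrow> bool" where
  "justified B M c x y \<longleftrightarrow>
    c = program_code Zero \<and> y = 0 \<or>
    c = program_code Successor \<and> y = Suc x \<or>
    c = program_code First \<and> y = pfst x \<or>
    c = program_code Second \<and> y = psnd x \<or>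
    c = program_code Query \<and> (x \<in> B \<and> y = 1 \<or> x \<notin> B \<and> y = 0) \<or>
    pfst c = 5 \<and> triple (pfst (psnd c)) x (pfst y) \<in> M \<and> triple (psnd (psnd c)) x (psnd y) \<in> M \<or>
    pfst c = 6 \<and> (\<exists>v. triple (psnd (psnd c)) x v \<in> M \<and> triple (pfst (psnd c)) v y \<in> M) \<or>
    pfst c = 7 \<and> psnd x = 0 \<and> triple (pfst (psnd c)) (pfst x) y \<in> M \<or>
    pfst c = 7 \<and> (\<exists>n<psnd x. psnd x = Suc n \<and> (\<exists>v. triple c (prod_encode (pfst x, n)) v \<in> M \<and>
      triple (psnd (psnd c)) (prod_encode (pfst x, prod_encode (n, v))) y \<in> M)) \<or>
    pfst c = 8 \<and> triple (psnd c) (prod_encode (x, y)) 0 \<in> M \<and>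
      (\<forall>m<y. \<exists>v. 0 < v \<and> triple (psnd c) (prod_encode (x, m)) v \<in> M)"

text \<open>The relation need not come with an order: each premise of a rule of \<^const>\<open>computes\<close>
  concerns a smaller program or the same program with a smaller recursion argument.\<close>

definition derivation :: "nat set \<Rightarrow> nat set \<Rightarrow> bool" where
  "derivation B M \<longleftrightarrow> (\<forall>t\<in>M. justified B M (pfst t) (pfst (psnd t)) (psnd (psnd t)))"

lemma justified_mono: "justified B M c x y \<Longrightarrow> M \<subseteq> N \<Longrightarrow> justified B N c x y"
  unfolding justified_def by (elim disjE; simp; meson subsetD)

lemma derivation_UN:
  assumes "\<And>M. M \<in> \<M> \<Longrightarrow> derivation B M"
  shows "derivation B (\<Union>\<M>)"
  unfolding derivation_def
proof
  fix t assume "t \<in> \<Union>\<M>"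
  then obtain M where "M \<in> \<M>" "t \<in> M" by blast
  with assms show "justified B (\<Union>\<M>) (pfst t) (pfst (psnd t)) (psnd (psnd t))"
    unfolding derivation_def by (blast intro: justified_mono)
qed

lemma derivation_insert:
  assumes "derivation B M" "justified B M c x y"
  shows "derivation B (insert (triple c x y) M)"
  using assms justified_mono[of B M _ _ _ "insert (triple c x y) M"]
  unfolding derivation_def by auto

lemma derivation_sound:
  assumes "derivation B M" "triple (program_code p) x y \<in> M"
  shows "computes B p x y"
  using assms(2)
proof (induction p arbitrary: x y)
  have just: "justified B M (program_code p) x y" if "triple (program_code p) x y \<in> M" for p x y
    using bspec[OF assms(1)[unfolded derivation_def] that] by simp
  {
    case Zero with just[OF Zero] show ?case
      by (simp add: justified_def) (blast intro: computes.intros)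
  next
    case Successor with just[OF Successor] show ?case
      by (simp add: justified_def computes.intros)
  next
    case First with just[OF First] show ?case
      by (simp add: justified_def computes_First)
  next
    case Second with just[OF Second] show ?case
      by (simp add: justified_def computes_Second)
  next
    case Query with just[OF Query] show ?case
      using computes.query[of B x] by (auto simp: justified_def)
  next
    case (Pairing p q)
    with just[OF Pairing(3)] have "computes B p x (pfst y)" "computes B q x (psnd y)"
      by (simp_all add: justified_def)
    then show ?case using computes.pairing by fastforce
  next
    case (Compose p q)
    from just[OF Compose(3)] obtain v
      where "triple (program_code q) x v \<in> M" "triple (program_code p) v y \<in> M"
      by (auto simp: justified_def)
    with Compose(1,2) show ?case by (blast intro: computes.compose)
  next
    case (PrimRec p q)
    have "computes B (PrimRec p q) (prod_encode (a, n)) y"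
      if "triple (program_code (PrimRec p q)) (prod_encode (a, n)) y \<in> M" for a n y
      using that
    proof (induction n arbitrary: y)
      case 0
      with just[OF 0] PrimRec(1) show ?case by (auto simp: justified_def intro: computes.rec_0)
    next
      case (Suc n)
      with just[OF Suc(2)] PrimRec(2) show ?case
        by (auto simp: justified_def intro: computes.rec_Suc)
    qed
    from this[of "pfst x" "psnd x"] PrimRec(3) show ?case by simp
  next
    case (Minimize p)
    from just[OF Minimize(2)] have "triple (program_code p) (prod_encode (x, y)) 0 \<in> M"
      "\<forall>m<y. \<exists>v>0. triple (program_code p) (prod_encode (x, m)) v \<in> M"
      by (simp_all add: justified_def)
    with Minimize(1) show ?case by (blast intro: computes.minimize)
  }
qed

lemma derivation_complete:
  assumes "computes B p x y"
  shows "\<exists>M. finite M \<and> derivation B M \<and> triple (program_code p) x y \<in> M"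
proof -
  \<comment> \<open>Derivations of finitely many premises are united and extended by the
    conclusion.\<close>
  have step: "\<exists>M. finite M \<and> derivation B M \<and> triple c x y \<in> M"
    if I: "finite I" and ex: "\<And>t. t \<in> I \<Longrightarrow> \<exists>M. finite M \<and> derivation B M \<and> t \<in> M"
      and just: "justified B I c x y" for I c x y
  proof -
    obtain m where m: "\<And>t. t \<in> I \<Longrightarrow> finite (m t) \<and> derivation B (m t) \<and> t \<in> m t"
      using ex by metis
    then have "derivation B (\<Union> (m ` I))" by (intro derivation_UN) auto
    moreover have "justified B (\<Union> (m ` I)) c x y"
      by (rule justified_mono[OF just]) (use m in blast)
    ultimately have "derivation B (insert (triple c x y) (\<Union> (m ` I)))" by (rule derivation_insert)
    moreover have "finite (\<Union> (m ` I))" using m I by blast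
    ultimately show ?thesis by (intro exI[of _ "insert (triple c x y) (\<Union> (m ` I))"]) simp
  qed
  show ?thesis using assms
  proof (induction rule: computes.induct)
    case (zero x)
    show ?case by (rule step[of "{}"]) (auto simp: justified_def)
  next
    case (successor x)
    show ?case by (rule step[of "{}"]) (auto simp: justified_def)
  next
    case (first x y)
    show ?case by (rule step[of "{}"]) (auto simp: justified_def)
  next
    case (second x y)
    show ?case by (rule step[of "{}"]) (auto simp: justified_def)
  next
    case (query x)
    show ?case by (rule step[of "{}"]) (auto simp: justified_def)
  next
    case (pairing p x y q z)
    show ?case
      by (rule step[of "{triple (program_code p) x y, triple (program_code q) x z}"])
        (simp, use pairing.IH in blast, simp add: justified_def)
  next
    case (compose q x y p z)
    show ?case
      by (rule step[of "{triple (program_code q) x y, triple (program_code p) y z}"])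
        (simp, use compose.IH in blast, simp add: justified_def, blast)
  next
    case (rec_0 p x y q)
    show ?case
      by (rule step[of "{triple (program_code p) x y}"])
        (simp, use rec_0.IH in blast, simp add: justified_def)
  next
    case (rec_Suc p q x n y z)
    show ?case
      by (rule step[of "{triple (program_code (PrimRec p q)) (prod_encode (x, n)) y,
            triple (program_code q) (prod_encode (x, prod_encode (n, y))) z}"])
        (simp, use rec_Suc.IH in blast, simp add: justified_def, blast)
  next
    case (minimize p x n)
    \<comment> \<open>Choosing one output for each \<open>m < n\<close> leaves finitely many
      premises.\<close>
    then obtain v where v: "\<And>m. m < n \<Longrightarrow> 0 < v m \<and>
        (\<exists>M. finite M \<and> derivation B M \<and> triple (program_code p) (prod_encode (x, m)) (v m) \<in> M)"
      by metis
    show ?case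
      by (rule step[of "insert (triple (program_code p) (prod_encode (x, n)) 0)
            ((\<lambda>m. triple (program_code p) (prod_encode (x, m)) (v m)) ` {..<n})"])
        (simp, use minimize.IH(1) v in blast, use v in \<open>simp add: justified_def, blast\<close>)
  qed
qed

text \<open>A version of Kleene's normal form: a computation is witnessed by a number whose
  correctness is decidable.\<close>

lemma computes_iff_derivation:
  "computes B p x y \<longleftrightarrow> (\<exists>s. derivation B (set_decode s) \<and> triple (program_code p) x y \<in> set_decode s)"
  using derivation_complete[of B p x y] derivation_sound[of B _ p x y]
  by (metis set_encode_inverse)

text \<open>The use principle: every oracle query of a derivation coded by \<open>s\<close> is
  smaller than \<open>s\<close>.\<close>

lemma derivation_cong:
  assumes "B \<inter> {..<s} = B' \<inter> {..<s}"
  shows "derivation B (set_decode s) = derivation B' (set_decode s)"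
  unfolding derivation_def
proof (rule ball_cong[OF refl])
  fix t assume "t \<in> set_decode s"
  then have "pfst (psnd t) < s"
    using set_decode_less[of t s] pfst_le[of "psnd t"] psnd_le[of t] by linarith
  then have "pfst (psnd t) \<in> B \<longleftrightarrow> pfst (psnd t) \<in> B'" using assms by blast
  then show "justified B (set_decode s) (pfst t) (pfst (psnd t)) (psnd (psnd t)) =
      justified B' (set_decode s) (pfst t) (pfst (psnd t)) (psnd (psnd t))"
    unfolding justified_def by simp
qed

text \<open>Bounds the existential quantifiers left open in \<open>justified\<close>, since the
  components of a member of a coded set are below its code.\<close>

lemma ex_triple_decode:
  "(\<exists>v. P v \<and> triple c x v \<in> set_decode s) \<longleftrightarrow> (\<exists>v<s. P v \<and> triple c x v \<in> set_decode s)"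
  using set_decode_less[of "triple c x _" s] triple_le(2)[of _ c x] by (meson le_less_trans)

lemma ex_triple_decode':
  "(\<exists>v. triple c x v \<in> set_decode s \<and> P v) \<longleftrightarrow> (\<exists>v<s. triple c x v \<in> set_decode s \<and> P v)"
  using ex_triple_decode[of P c x s] by (simp only: conj_commute)

text \<open>The oracle of the inspected derivation may vary with the input. This allows one to ask
  what finite oracles, given by their codes, can compute.\<close>

lemma decidable_derivation:
  assumes Q: "decidable B (\<lambda>z. Q (pfst z) (psnd z))" and f: "computable B f"
  shows "decidable B (\<lambda>x. derivation {u. Q x u} (set_decode (f x)))"
  unfolding derivation_def justified_def mem_Collect_eq
  unfolding ex_triple_decode ex_triple_decode'
  unfolding triple_def
  by (intro decidable_intros decidable_comp2[OF Q] f computable_comp[OF f])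

text \<open>The second argument of a \<^const>\<open>PrimRec\<close> may be irrelevant for a derivation, so that
  derivations alone do not detect whether a number codes a program.\<close>

definition codes_closed :: "nat set \<Rightarrow> bool" where
  "codes_closed M \<longleftrightarrow> (\<forall>c\<in>M.
    c = program_code Zero \<or> c = program_code Successor \<or> c = program_code First \<or>
    c = program_code Second \<or> c = program_code Query \<or>
    (pfst c = 5 \<or> pfst c = 6 \<or> pfst c = 7) \<and> pfst (psnd c) \<in> M \<and> psnd (psnd c) \<in> M \<or>
    pfst c = 8 \<and> psnd c \<in> M)"

text \<open>Compound programs have positive tags, so induction on codes reaches their parts.\<close>

lemma psnd_less:
  assumes "0 < pfst c"
  shows "psnd c < c"
proof -
  have "n \<le> triangle n" for n by (induction n) auto
  from this[of "pfst c + psnd c"] have "pfst c + psnd c \<le> prod_encode (pfst c, psnd c)"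
    by (simp add: prod_encode_def del: encode_pfst_psnd)
  with assms show ?thesis by simp
qed

lemma program_code_if_closed:
  assumes "codes_closed M"
  shows "c \<in> M \<Longrightarrow> \<exists>p. c = program_code p"
proof (induction c rule: less_induct)
  case (less c)
  have less_psnd: "psnd c < c \<and> psnd (psnd c) < c \<and> pfst (psnd c) < c" if "0 < pfst c"
    using psnd_less[OF that] pfst_le[of "psnd c"] psnd_le[of "psnd c"] by linarith
  have c: "c = prod_encode (pfst c, prod_encode (pfst (psnd c), psnd (psnd c)))" by simp
  consider "c \<in> program_code ` {Zero, Successor, First, Second, Query}"
    | "pfst c \<in> {5, 6, 7}" "pfst (psnd c) \<in> M" "psnd (psnd c) \<in> M"
    | "pfst c = 8" "psnd c \<in> M"
    using bspec[OF assms[unfolded codes_closed_def] less.prems] by auto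
  then show ?case
  proof cases
    case 1 then show ?thesis by blast
  next
    case 2
    then have "0 < pfst c" by auto
    with 2 less.IH less_psnd obtain p q
      where pq: "pfst (psnd c) = program_code p" "psnd (psnd c) = program_code q" by meson
    have "c = program_code (Pairing p q) \<or> c = program_code (Compose p q) \<or> c = program_code (PrimRec p q)"
      using 2(1) c unfolding pq by auto
    then show ?thesis by blast
  next
    case 3
    with less.IH less_psnd obtain p where "psnd c = program_code p" by auto
    with 3(1) have "c = program_code (Minimize p)" using encode_pfst_psnd[of c] by simp
    then show ?thesis by blast
  qed
qed

lemma ex_codes_closed: "\<exists>M. finite M \<and> codes_closed M \<and> program_code p \<in> M"
proof -
  have two: "\<exists>M. finite M \<and> codes_closed M \<and> prod_encode (k, prod_encode (program_code p, program_code q)) \<in> M"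
    if "finite M" "codes_closed M" "program_code p \<in> M" "finite N" "codes_closed N" "program_code q \<in> N"
      "k \<in> {5, 6, 7}" for p q k M N
    using that
    by (intro exI[of _ "insert (prod_encode (k, prod_encode (program_code p, program_code q))) (M \<union> N)"])
      (auto simp: codes_closed_def)
  have base: "\<exists>M. finite M \<and> codes_closed M \<and> program_code p \<in> M"
    if "p \<in> {Zero, Successor, First, Second, Query}" for p
    using that by (intro exI[of _ "{program_code p}"]) (auto simp: codes_closed_def)
  show ?thesis
  proof (induction p)
    case (Minimize p)
    then obtain M where "finite M" "codes_closed M" "program_code p \<in> M" by blast
    then show ?case
      by (intro exI[of _ "insert (prod_encode (8, program_code p)) M"]) (auto simp: codes_closed_def)
  next
    case (Pairing p q)
    then obtain M N where "finite M" "codes_closed M" "program_code p \<in> M"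
      "finite N" "codes_closed N" "program_code q \<in> N" by blast
    from two[OF this] show ?case by simp
  next
    case (Compose p q)
    then obtain M N where "finite M" "codes_closed M" "program_code p \<in> M"
      "finite N" "codes_closed N" "program_code q \<in> N" by blast
    from two[OF this] show ?case by simp
  next
    case (PrimRec p q)
    then obtain M N where "finite M" "codes_closed M" "program_code p \<in> M"
      "finite N" "codes_closed N" "program_code q \<in> N" by blast
    from two[OF this] show ?case by simp
  qed (rule base; simp)+
qed

lemma ce_in_halting_set: "ce_in {} halting_set"
proof -
  \<comment> \<open>The witness \<open>m\<close> pairs a set of codes, certifying that
    \<open>pfst k\<close> codes a program, with a derivation of a halting computation of it.\<close>
  define P where "P k m \<longleftrightarrow> codes_closed (set_decode (pfst m)) \<and> pfst k \<in> set_decode (pfst m) \<and>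
    derivation {} (set_decode (psnd m)) \<and> (\<exists>y<psnd m. triple (pfst k) (psnd k) y \<in> set_decode (psnd m))" for k m
  have "k \<in> halting_set \<longleftrightarrow> (\<exists>m. P k m)" for k
  proof
    assume "k \<in> halting_set"
    then obtain p x y where k: "k = prod_encode (program_code p, x)" and y: "computes {} p x y"
      unfolding halting_set_def by blast
    obtain M where M: "finite M" "codes_closed M" "program_code p \<in> M" using ex_codes_closed by blast
    obtain s where s: "derivation {} (set_decode s)" "triple (program_code p) x y \<in> set_decode s"
      using y computes_iff_derivation by blast
    then have "y < s" using set_decode_less triple_le(2) le_less_trans by blast
    with M k s have "P k (prod_encode (set_encode M, s))" unfolding P_def by auto
    then show "\<exists>m. P k m" ..
  next
    assume "\<exists>m. P k m"
    then obtain m y where "codes_closed (set_decode (pfst m))" "pfst k \<in> set_decode (pfst m)"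
      and d: "derivation {} (set_decode (psnd m))" "triple (pfst k) (psnd k) y \<in> set_decode (psnd m)"
      unfolding P_def by blast
    then obtain p where p: "pfst k = program_code p" using program_code_if_closed by blast
    with d have "computes {} p (psnd k) y" by (simp add: derivation_sound)
    moreover have "k = prod_encode (program_code p, psnd k)" by (simp flip: p)
    ultimately show "k \<in> halting_set" unfolding halting_set_def by blast
  qed
  then have "halting_set = {k. \<exists>m. P k m}" by blast
  moreover have "decidable {} (\<lambda>z. P (pfst z) (psnd z))"
    unfolding P_def codes_closed_def triple_def
    by (intro decidable_intros decidable_derivation[of _ "\<lambda>_ _. False", simplified])
  ultimately show ?thesis using ce_inI[of "{}" P] by (simp only:)
qed

lemma reducible_halting_set_if_computably_enumerable:
  assumes "computably_enumerable W"
  shows "turing_reducible W halting_set"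
proof -
  obtain p where W: "W = {x. \<exists>y. computes {} p x y}"
    using assms unfolding computably_enumerable_def by blast
  have *: "x \<in> W \<longleftrightarrow> prod_encode (program_code p, x) \<in> halting_set" for x
    unfolding W halting_set_def by (auto simp: program_code_inject)
  show ?thesis
    unfolding turing_reducible_iff_decidable *
    by (intro decidable_oracle decidable_intros)
qed

section \<open>Joins and enumeration operators\<close>

definition join :: "nat set \<Rightarrow> nat set \<Rightarrow> nat set" where
  "join A B = {x. pfst x = 0 \<and> psnd x \<in> A \<or> pfst x \<noteq> 0 \<and> psnd x \<in> B}"

lemma reducible_join1: "turing_reducible A (join A B)"
proof -
  have *: "x \<in> A \<longleftrightarrow> prod_encode (0, x) \<in> join A B" for x by (simp add: join_def)
  show ?thesis unfolding turing_reducible_iff_decidable *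
    by (intro decidable_oracle decidable_intros)
qed

lemma reducible_join2: "turing_reducible B (join A B)"
proof -
  have *: "x \<in> B \<longleftrightarrow> prod_encode (1, x) \<in> join A B" for x by (simp add: join_def)
  show ?thesis unfolding turing_reducible_iff_decidable *
    by (intro decidable_oracle decidable_intros)
qed

lemma join_reducible:
  assumes "turing_reducible A C" "turing_reducible B C"
  shows "turing_reducible (join A B) C"
  unfolding turing_reducible_iff_decidable join_def mem_Collect_eq
  by (intro decidable_intros decidable_reducible assms)

text \<open>\<open>s\<close> codes one derivation by which \<open>p\<close> accepts \<open>n\<close>
  with some auxiliary \<open>m\<close>, using the join of \<open>Z\<close> and \<open>A\<close>. It
  is not a time bound: the predicate need not be monotone in \<open>s\<close>.\<close>

definition stage :: "nat set \<Rightarrow> program \<Rightarrow> nat \<Rightarrow> nat \<Rightarrow> nat set \<Rightarrow> bool" where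
  "stage Z p n s A \<longleftrightarrow> derivation (join Z A) (set_decode s) \<and>
    (\<exists>m<s. triple (program_code p) (prod_encode (n, m)) 1 \<in> set_decode s)"

text \<open>By the use principle, since a query \<open>x\<close> to the join concerns only
  \<open>psnd x \<le> x\<close>.\<close>

lemma stage_cong:
  assumes "A \<inter> {..<s} = A' \<inter> {..<s}"
  shows "stage Z p n s A \<longleftrightarrow> stage Z p n s A'"
proof -
  have "x \<in> join Z A \<longleftrightarrow> x \<in> join Z A'" if "x < s" for x
  proof -
    have "psnd x < s" using that psnd_le[of x] by simp
    then have "psnd x \<in> A \<longleftrightarrow> psnd x \<in> A'" using assms by blast
    then show ?thesis unfolding join_def by simp
  qed
  then have "join Z A \<inter> {..<s} = join Z A' \<inter> {..<s}" by blast
  from derivation_cong[OF this] show ?thesis unfolding stage_def by (simp only:)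
qed

lemma decidable_stage:
  assumes "decidable B (\<lambda>z. Q (pfst z) (psnd z))" "turing_reducible Z B" "computable B f" "computable B g"
  shows "decidable B (\<lambda>x. stage Z p (f x) (g x) {u. Q x u})"
  unfolding stage_def join_def triple_def mem_Collect_eq
  by (intro decidable_intros decidable_derivation decidable_reducible decidable_comp2[OF assms(1)]
      assms computable_comp[OF assms(3)] computable_comp[OF assms(4)])

text \<open>Reduces non-enumerability in a join to countably many requirements, one for each
  program.\<close>

lemma ce_in_join_stage:
  assumes "ce_in (join Z A) D"
  shows "\<exists>p. D = {n. \<exists>s. stage Z p n s A}"
proof -
  obtain P where P: "decidable (join Z A) (\<lambda>z. P (pfst z) (psnd z))" and D: "D = {x. \<exists>y. P x y}"
    using assms by (rule ce_inE)
  obtain p where p: "\<And>z. computes (join Z A) p z (of_bool (P (pfst z) (psnd z)))"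
    using P unfolding decidable_def computable_def by blast
  have "P n m \<longleftrightarrow> computes (join Z A) p (prod_encode (n, m)) 1" for n m
    using p[of "prod_encode (n, m)"] computes_deterministic[OF p[of "prod_encode (n, m)"], of 1]
    by (cases "P n m") auto
  then have P: "P n m \<longleftrightarrow> (\<exists>s. derivation (join Z A) (set_decode s) \<and>
      triple (program_code p) (prod_encode (n, m)) 1 \<in> set_decode s)" for n m
    by (simp add: computes_iff_derivation)
  have "m < s" if "triple (program_code p) (prod_encode (n, m)) 1 \<in> set_decode s" for n m s
    using set_decode_less[OF that] triple_le(1)[of "prod_encode (n, m)" "program_code p" 1]
      le_prod_encode_2[of m n] by linarith
  then have "D = {n. \<exists>s. stage Z p n s A}" unfolding D P stage_def by blast
  then show ?thesis ..
qed

section \<open>Avoiding a set inside a nonempty effectively closed class\<close>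

text \<open>Each \<open>T s\<close> is a clopen condition decided by the first \<open>s\<close>
  bits. Hence \<open>\<forall>s. T s A\<close> defines a closed set of Cantor space and
  \<open>\<exists>s. T s A\<close> an open one.\<close>

definition finitary :: "(nat \<Rightarrow> nat set \<Rightarrow> bool) \<Rightarrow> bool" where
  "finitary T \<longleftrightarrow> (\<forall>s A A'. A \<inter> {..<s} = A' \<inter> {..<s} \<longrightarrow> T s A = T s A')"

lemma finitaryD: "finitary T \<Longrightarrow> A \<inter> {..<s} = A' \<inter> {..<s} \<Longrightarrow> T s A = T s A'"
  unfolding finitary_def by blast

lemma finitary_stage: "finitary (\<lambda>s. stage Z p n s)"
  unfolding finitary_def using stage_cong by blast

lemma Int_lessThan_mono:
  fixes A A' :: "nat set"
  assumes "A \<inter> {..<k} = A' \<inter> {..<k}" "s \<le> k"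
  shows "A \<inter> {..<s} = A' \<inter> {..<s}"
proof -
  have "A \<inter> {..<s} = (A \<inter> {..<k}) \<inter> {..<s}" for A :: "nat set" using assms(2) by auto
  from this[of A] this[of A'] assms(1) show ?thesis by simp
qed

text \<open>Koenig's lemma: if no bound \<open>k\<close> works, there is an infinite path of finite
  strings none of which is covered with any bound, and its limit contradicts
  \<open>cover\<close>.\<close>

lemma Cantor_compactness:
  assumes fin: "finitary T" and cover: "\<And>Y. \<exists>s. T s Y"
  shows "\<exists>k. \<forall>Y. \<exists>s\<le>k. T s Y"
proof (rule ccontr)
  assume neg: "\<not> ?thesis"
  \<comment> \<open>The string \<open>S\<close> of length \<open>m\<close> has, for every bound
    \<open>k\<close>, an extension not covered up to \<open>k\<close>.\<close>
  define ok where "ok m S \<longleftrightarrow> (\<forall>k. \<exists>Y. Y \<inter> {..<m} = S \<and> (\<forall>s\<le>k. \<not> T s Y))" for m S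
  have "\<exists>f. \<forall>n. ok n (f n) \<and> f (Suc n) \<inter> {..<n} = f n"
  proof (rule dependent_nat_choice)
    show "\<exists>S. ok 0 S" using neg unfolding ok_def by (intro exI[of _ "{}"]) auto
  next
    fix S m assume S: "ok m S"
    show "\<exists>S'. ok (Suc m) S' \<and> S' \<inter> {..<m} = S"
    proof (rule ccontr)
      assume *: "\<not> ?thesis"
      have sub: "S \<subseteq> {..<m}" using S unfolding ok_def by blast
      then have "S \<inter> {..<m} = S" "insert m S \<inter> {..<m} = S" by auto
      with * have "\<not> ok (Suc m) S" "\<not> ok (Suc m) (insert m S)" by blast+
      then obtain k1 k2 where k1: "\<And>Y. Y \<inter> {..<Suc m} = S \<Longrightarrow> \<exists>s\<le>k1. T s Y"
        and k2: "\<And>Y. Y \<inter> {..<Suc m} = insert m S \<Longrightarrow> \<exists>s\<le>k2. T s Y"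
        unfolding ok_def by meson
      obtain Y where Y: "Y \<inter> {..<m} = S" "\<forall>s\<le>max k1 k2. \<not> T s Y"
        using S unfolding ok_def by blast
      have "Y \<inter> {..<Suc m} = S \<or> Y \<inter> {..<Suc m} = insert m S"
        using Y(1) by (auto simp: lessThan_Suc)
      then show False using k1[of Y] k2[of Y] Y(2) by (meson le_max_iff_disj)
    qed
  qed
  then obtain f where f: "\<And>n. ok n (f n)" "\<And>n. f (Suc n) \<inter> {..<n} = f n" by blast
  have stable: "f (m + d) \<inter> {..<m} = f m" for m d
  proof (induction d)
    case 0 show ?case using f(1)[of m] unfolding ok_def by auto
  next
    case (Suc d)
    have "f (Suc (m + d)) \<inter> {..<m} = (f (Suc (m + d)) \<inter> {..<m + d}) \<inter> {..<m}" by auto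
    with Suc f(2) show ?case by simp
  qed
  define Y where "Y = (\<Union>n. f n)"
  have Y: "Y \<inter> {..<m} = f m" for m
  proof -
    have "f n \<inter> {..<m} \<subseteq> f m" for n
    proof (cases "n \<le> m")
      case True
      with stable[of n "m - n"] show ?thesis by auto
    next
      case False
      with stable[of m "n - m"] show ?thesis by auto
    qed
    moreover have "f m \<subseteq> {..<m}" using stable[of m 0] by auto
    ultimately show ?thesis unfolding Y_def by blast
  qed
  obtain s where s: "T s Y" using cover by blast
  obtain Y' where Y': "Y' \<inter> {..<s} = f s" "\<not> T s Y'" using f(1)[of s] unfolding ok_def by blast
  then show False using finitaryD[OF fin, of Y' s Y] s Y by simp
qed

lemma ex_decode_Int: "\<exists>a<2 ^ k. set_decode a = Y \<inter> {..<k}"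
proof (intro exI conjI)
  show "set_decode (set_encode (Y \<inter> {..<k})) = Y \<inter> {..<k}" by simp
  then show "set_encode (Y \<inter> {..<k}) < 2 ^ k"
    using set_decode_subset_less[of "set_encode (Y \<inter> {..<k})" k] by simp
qed

text \<open>Replaces a quantifier over all sets by an existential number quantifier followed by
  bounded ones, so that the questions asked in forcing arguments are enumerable.\<close>

lemma Cantor_compactness_decode:
  assumes "finitary T"
  shows "(\<forall>Y. \<exists>s. T s Y) \<longleftrightarrow> (\<exists>k. \<forall>a<2 ^ k. \<exists>s\<le>k. T s (set_decode a))"
proof
  assume "\<forall>Y. \<exists>s. T s Y"
  with Cantor_compactness[OF assms] show "\<exists>k. \<forall>a<2 ^ k. \<exists>s\<le>k. T s (set_decode a)" by meson
next
  assume "\<exists>k. \<forall>a<2 ^ k. \<exists>s\<le>k. T s (set_decode a)"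
  then obtain k where k: "\<And>a. a < 2 ^ k \<Longrightarrow> \<exists>s\<le>k. T s (set_decode a)" by blast
  show "\<forall>Y. \<exists>s. T s Y"
  proof
    fix Y
    obtain a where a: "a < 2 ^ k" "set_decode a = Y \<inter> {..<k}" using ex_decode_Int by blast
    with k obtain s where "s \<le> k" "T s (set_decode a)" by blast
    moreover have "set_decode a \<inter> {..<k} = Y \<inter> {..<k}" using a(2) by auto
    ultimately have "T s Y" using finitaryD[OF assms Int_lessThan_mono] by blast
    then show "\<exists>s. T s Y" ..
  qed
qed

lemma decidable_stage_decode:
  assumes "turing_reducible Z B" "computable B f" "computable B g" "computable B h"
  shows "decidable B (\<lambda>x. stage Z p (f x) (g x) (set_decode (h x)))"
proof -
  have "decidable B (\<lambda>x. stage Z p (f x) (g x) {u. u \<in> set_decode (h x)})"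
    by (intro decidable_stage decidable_intros computable_comp[OF assms(4)] assms)
  then show ?thesis by (simp only: Collect_mem_eq)
qed

text \<open>An enumeration of all programs; numbers that code no program get an arbitrary
  one.\<close>

definition nth_program :: "nat \<Rightarrow> program" where "nth_program = inv program_code"

lemma nth_program_code [simp]: "nth_program (program_code p) = p"
  unfolding nth_program_def by (rule inv_f_f) (simp add: inj_def program_code_inject)

text \<open>Presents the \<open>\<Pi>\<^sup>0\<^sub>1\<close> class relative to \<open>B\<close> of
  all \<open>Y\<close> with \<open>\<forall>s. T s Y\<close>. Codes of finite sets suffice for
  deciding \<open>T\<close>, which sees only an initial segment of \<open>Y\<close>.\<close>

definition closed_class :: "nat set \<Rightarrow> (nat \<Rightarrow> nat set \<Rightarrow> bool) \<Rightarrow> bool" where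
  "closed_class B T \<longleftrightarrow> finitary T \<and> decidable B (\<lambda>z. T (pfst z) (set_decode (psnd z)))"

text \<open>\<open>Q\<close> collects the \<open>n\<close> enumerated by all members of the class.
  It is c.e. in \<open>B\<close> by compactness and so differs from \<open>D\<close>. For
  \<open>n\<close> in \<open>Q\<close> but not in \<open>D\<close> the class is kept; for
  \<open>n\<close> in \<open>D\<close> but not in \<open>Q\<close> it shrinks to the members that do
  not enumerate \<open>n\<close>.\<close>

lemma closed_class_decide:
  assumes T: "closed_class B T" "\<exists>Y. \<forall>s. T s Y" and D: "\<not> ce_in B D"
  shows "\<exists>T'. closed_class B T' \<and> (\<exists>Y. \<forall>s. T' s Y) \<and> (\<forall>s Y. T' s Y \<longrightarrow> T s Y) \<and>
    (\<forall>Y. (\<forall>s. T' s Y) \<longrightarrow> D \<noteq> {n. \<exists>s. stage B p n s Y})"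
proof -
  \<comment> \<open>\<open>Y\<close> is seen at \<open>s\<close> to leave the class or to enumerate
    \<open>n\<close>.\<close>
  define U where "U n s Y \<longleftrightarrow> \<not> T s Y \<or> stage B p n s Y" for n s Y
  have dT: "decidable B (\<lambda>z. T (pfst z) (set_decode (psnd z)))" and fT: "finitary T"
    using T(1) unfolding closed_class_def by blast+
  have fU: "finitary (U n)" for n
    unfolding finitary_def U_def
    using finitaryD[OF fT] finitaryD[OF finitary_stage, of _ _ _ B p n] by blast
  define Q where "Q = {n. \<exists>k. \<forall>a<2 ^ k. \<exists>s\<le>k. U n s (set_decode a)}"
  have Q: "n \<in> Q \<longleftrightarrow> (\<forall>Y. \<exists>s. U n s Y)" for n
    unfolding Q_def mem_Collect_eq Cantor_compactness_decode[OF fU] ..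
  have "turing_reducible B B" by (rule turing_reducible_refl)
  then have "ce_in B Q" unfolding Q_def U_def
    by (intro ce_inI decidable_intros decidable_stage_decode
        decidable_comp2[OF dT])
  with D have "Q \<noteq> D" by blast
  then consider n where "n \<in> Q" "n \<notin> D" | n where "n \<in> D" "n \<notin> Q" by blast
  then show ?thesis
  proof cases
    case 1
    then have "\<exists>s. stage B p n s Y" if "\<forall>s. T s Y" for Y
      using that unfolding Q U_def by blast
    with 1 have "D \<noteq> {n. \<exists>s. stage B p n s Y}" if "\<forall>s. T s Y" for Y using that by blast
    with T show ?thesis by blast
  next
    case 2
    define T' where "T' s Y \<longleftrightarrow> T s Y \<and> \<not> stage B p n s Y" for s Y
    have "closed_class B T'" unfolding closed_class_def
    proof
      show "finitary T'" unfolding finitary_def T'_def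
        using finitaryD[OF fT] finitaryD[OF finitary_stage, of _ _ _ B p n] by blast
      show "decidable B (\<lambda>z. T' (pfst z) (set_decode (psnd z)))" unfolding T'_def
        by (intro decidable_intros decidable_stage_decode dT turing_reducible_refl)
    qed
    moreover have "\<exists>Y. \<forall>s. T' s Y" using 2(2) unfolding Q U_def T'_def by blast
    moreover have "D \<noteq> {n. \<exists>s. stage B p n s Y}" if "\<forall>s. T' s Y" for Y
      using that 2(1) unfolding T'_def by blast
    moreover have "T' s Y \<longrightarrow> T s Y" for s Y unfolding T'_def by blast
    ultimately show ?thesis by blast
  qed
qed

text \<open>One program is handled after the other by shrinking the class. A decreasing sequence of
  nonempty closed classes has a common member.\<close>

lemma closed_class_avoidance:
  assumes T: "closed_class B T" "\<exists>Y. \<forall>s. T s Y" and D: "\<not> ce_in B D"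
  shows "\<exists>Y. (\<forall>s. T s Y) \<and> \<not> ce_in (join B Y) D"
proof -
  let ?P = "\<lambda>(n :: nat) T'. closed_class B T' \<and> (\<exists>Y. \<forall>s. T' s Y) \<and> (n = 0 \<longrightarrow> T' = T)"
  let ?Q = "\<lambda>(n :: nat) T T'. (\<forall>s Y. T' s Y \<longrightarrow> T s Y) \<and>
      (\<forall>Y. (\<forall>s. T' s Y) \<longrightarrow> D \<noteq> {m. \<exists>s. stage B (nth_program n) m s Y})"
  have "\<exists>f. \<forall>n. ?P n (f n) \<and> ?Q n (f n) (f (Suc n))"
  proof (rule dependent_nat_choice)
    show "\<exists>T'. ?P 0 T'" using T by blast
  next
    fix T' n assume "?P n T'"
    then have "closed_class B T'" "\<exists>Y. \<forall>s. T' s Y" by simp_all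
    from closed_class_decide[OF this D, of "nth_program n"]
    show "\<exists>T''. ?P (Suc n) T'' \<and> ?Q n T' T''" by simp
  qed
  then obtain f where PQ: "\<forall>n. ?P n (f n) \<and> ?Q n (f n) (f (Suc n))" ..
  have P: "?P n (f n)" and Q: "?Q n (f n) (f (Suc n))" for n
    using spec[OF PQ, of n] by (rule conjunct1, rule conjunct2)
  have mono: "f (m + d) s Y \<Longrightarrow> f m s Y" for m d s Y
  proof (induction d)
    case (Suc d)
    then have "f (m + d) s Y" using Q[of "m + d"] by simp
    then show ?case by (rule Suc.IH)
  qed simp
  \<comment> \<open>\<open>Y\<close> is seen within \<open>k\<close> to leave one of the classes up
    to index \<open>k\<close>. If this covered every \<open>Y\<close>, some bound \<open>k\<close>
    would do, but a member of the class with index \<open>k\<close> lies in all earlier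
    ones.\<close>
  define U where "U k Y \<longleftrightarrow> (\<exists>i\<le>k. \<exists>s\<le>k. \<not> f i s Y)" for k Y
  have fin: "finitary U"
    unfolding finitary_def
  proof (intro allI impI)
    fix k and A A' :: "nat set" assume A: "A \<inter> {..<k} = A' \<inter> {..<k}"
    have "f i s A \<longleftrightarrow> f i s A'" if "s \<le> k" for i s
    proof -
      have "finitary (f i)" using P[of i] unfolding closed_class_def by blast
      then show ?thesis using Int_lessThan_mono[OF A that] by (rule finitaryD)
    qed
    then show "U k A \<longleftrightarrow> U k A'" unfolding U_def by blast
  qed
  have "\<not> (\<forall>Y. \<exists>k. U k Y)"
  proof
    assume "\<forall>Y. \<exists>k. U k Y"
    then obtain k where k: "\<forall>Y. \<exists>s\<le>k. U s Y" using Cantor_compactness[OF fin] by blast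
    obtain Y where Y: "\<forall>s. f k s Y" using P[of k] by blast
    obtain j i s where "j \<le> k" "i \<le> j" "\<not> f i s Y" using k unfolding U_def by blast
    with mono[of i "k - i" s Y] Y show False by simp
  qed
  then obtain Y where Y: "\<And>k. \<not> U k Y" by blast
  have "f i s Y" for i s using Y[of "max i s"] unfolding U_def by auto
  then have all: "\<forall>s. f i s Y" for i by blast
  have "\<not> ce_in (join B Y) D"
  proof
    assume "ce_in (join B Y) D"
    then obtain p where "D = {n. \<exists>s. stage B p n s Y}" using ce_in_join_stage by blast
    moreover have "D \<noteq> {n. \<exists>s. stage B (nth_program (program_code p)) n s Y}"
      using Q[of "program_code p"] all[of "Suc (program_code p)"] by blast
    ultimately show False by simp
  qed
  moreover have "\<forall>s. T s Y" using all[of 0] P[of 0] by simp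
  ultimately show ?thesis by blast
qed

section \<open>Greedy thinning\<close>

text \<open>A number of \<open>R\<close> enters \<open>H\<close> if it forms a good pair with every
  earlier element of \<open>H\<close>. A finite \<open>H\<close> could reject only finitely many
  numbers, as each of its elements rejects finitely many.\<close>

lemma thin_homogeneous:
  assumes c: "decidable B (\<lambda>z. c (pfst z) (psnd z))" and R: "turing_reducible R B" "infinite R"
    and lim: "\<And>x. x \<in> R \<Longrightarrow> finite {y \<in> R. \<not> c x y}"
  shows "\<exists>H\<subseteq>R. infinite H \<and> turing_reducible H B \<and> (\<forall>x\<in>H. \<forall>y\<in>H. x < y \<longrightarrow> c x y)"
proof -
  \<comment> \<open>\<open>g n\<close> will be the part of \<open>H\<close> below
    \<open>n\<close>.\<close>
  define g where "g = rec_nat {} (\<lambda>n S. if n \<in> R \<and> (\<forall>z\<in>S. c z n) then insert n S else S)"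
  have g: "g 0 = {}" "g (Suc n) = (if n \<in> R \<and> (\<forall>z\<in>g n. c z n) then insert n (g n) else g n)" for n
    by (simp_all add: g_def)
  define H where "H = (\<Union>n. g n)"
  have H_less: "H \<inter> {..<n} = g n" for n
  proof -
    have sub: "g n \<subseteq> {..<n}" for n by (induction n) (auto simp: g)
    have stable: "g (m + d) \<inter> {..<m} = g m" for m d
      using sub[of m] by (induction d) (auto simp: g)
    have "g m \<inter> {..<n} \<subseteq> g n" for m
    proof (cases "m \<le> n")
      case True
      with stable[of m "n - m"] show ?thesis by auto
    next
      case False
      with stable[of n "m - n"] show ?thesis by auto
    qed
    with sub[of n] show ?thesis unfolding H_def by blast
  qed
  have H_iff: "x \<in> H \<longleftrightarrow> x \<in> R \<and> (\<forall>z<x. z \<in> H \<longrightarrow> c z x)" for x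
  proof -
    have "x \<in> H \<longleftrightarrow> x \<in> g (Suc x)" using H_less[of "Suc x"] by auto
    also have "\<dots> \<longleftrightarrow> x \<in> R \<and> (\<forall>z\<in>g x. c z x)" using H_less[of x] by (auto simp: g)
    finally show ?thesis unfolding H_less[of x, symmetric] by blast
  qed
  \<comment> \<open>\<open>h\<close> codes the history of the construction up to \<open>x\<close>;
    the bounded search over all such codes makes \<open>H\<close> decidable.\<close>
  have H_decode: "x \<in> H \<longleftrightarrow> (\<exists>h<2 ^ Suc x. (\<forall>y<Suc x. y \<in> set_decode h \<longleftrightarrow>
      y \<in> R \<and> (\<forall>z<y. z \<in> set_decode h \<longrightarrow> c z y)) \<and> x \<in> set_decode h)" (is "_ \<longleftrightarrow> ?rhs") for x
  proof
    assume x: "x \<in> H"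
    obtain h where h: "h < 2 ^ Suc x" "set_decode h = H \<inter> {..<Suc x}" using ex_decode_Int by blast
    have "y \<in> set_decode h \<longleftrightarrow> y \<in> R \<and> (\<forall>z<y. z \<in> set_decode h \<longrightarrow> c z y)" if "y < Suc x" for y
      using H_iff[of y] that unfolding h(2) by auto
    with h x show ?rhs by blast
  next
    assume ?rhs
    then obtain h where h: "\<And>y. y < Suc x \<Longrightarrow> y \<in> set_decode h \<longleftrightarrow>
        y \<in> R \<and> (\<forall>z<y. z \<in> set_decode h \<longrightarrow> c z y)" and x: "x \<in> set_decode h" by blast
    have "y < Suc x \<Longrightarrow> y \<in> set_decode h \<longleftrightarrow> y \<in> H" for y
    proof (induction y rule: less_induct)
      case (less y)
      then have "(\<forall>z<y. z \<in> set_decode h \<longrightarrow> c z y) \<longleftrightarrow> (\<forall>z<y. z \<in> H \<longrightarrow> c z y)"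
        using less_trans by blast
      with h[OF less.prems] H_iff[of y] show ?case by blast
    qed
    with x show "x \<in> H" by blast
  qed
  have "turing_reducible H B"
    unfolding turing_reducible_iff_decidable H_decode
    by (intro decidable_intros decidable_reducible[OF R(1)] decidable_comp2[OF c])
  moreover have "H \<subseteq> R" using H_iff by blast
  moreover have "infinite H"
  proof
    assume "finite H"
    then have "finite (H \<union> (\<Union>z\<in>H. {y \<in> R. \<not> c z y}))"
      using lim \<open>H \<subseteq> R\<close> by blast
    moreover have "R \<subseteq> H \<union> (\<Union>z\<in>H. {y \<in> R. \<not> c z y})"
      using H_iff by blast
    ultimately show False using R(2) finite_subset by blast
  qed
  moreover have "\<forall>x\<in>H. \<forall>y\<in>H. x < y \<longrightarrow> c x y" using H_iff by blast
  ultimately show ?thesis by blast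
qed

section \<open>Homogeneous sets avoiding a set\<close>

definition avoids :: "nat set \<Rightarrow> nat set \<Rightarrow> nat set \<Rightarrow> bool" where
  "avoids Z D S \<longleftrightarrow> infinite S \<and> \<not> ce_in (join Z S) D"

lemma avoids_reducible:
  assumes "avoids Z D S" "infinite S'" "turing_reducible S' (join Z S)"
  shows "avoids Z D S'"
  using assms ce_in_reduce[OF _ join_reducible[OF reducible_join1 assms(3)]]
  unfolding avoids_def by blast

lemma avoids_filter:
  assumes "avoids Z D S" "infinite {y \<in> S. P y}" "decidable (join Z S) P"
  shows "avoids Z D {y \<in> S. P y}"
proof (rule avoids_reducible[OF assms(1,2)])
  show "turing_reducible {y \<in> S. P y} (join Z S)"
    unfolding turing_reducible_iff_decidable mem_Collect_eq
    by (intro decidable_conj decidable_reducible[OF reducible_join2] computable_id assms(3))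
qed

lemma avoids_above:
  assumes "avoids Z D S"
  shows "avoids Z D {y \<in> S. k \<le> y}"
proof (rule avoids_filter[OF assms])
  have "{y \<in> S. k \<le> y} = S - {..<k}" by auto
  with assms show "infinite {y \<in> S. k \<le> y}" unfolding avoids_def by simp
  show "decidable (join Z S) (\<lambda>y. k \<le> y)" by (intro decidable_intros)
qed

definition homogeneous :: "(nat \<Rightarrow> nat \<Rightarrow> bool) \<Rightarrow> bool \<Rightarrow> nat set \<Rightarrow> bool" where
  "homogeneous c i E \<longleftrightarrow> (\<forall>x\<in>E. \<forall>y\<in>E. x < y \<longrightarrow> c x y = i)"

lemma homogeneous_subset: "homogeneous c i E \<Longrightarrow> E' \<subseteq> E \<Longrightarrow> homogeneous c i E'"
  unfolding homogeneous_def by blast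

lemma ex_infinite_color:
  assumes "infinite S"
  shows "\<exists>i :: bool. infinite {x \<in> S. P x = i}"
proof (rule ccontr)
  assume "\<not> ?thesis"
  then have "finite ({x \<in> S. P x = True} \<union> {x \<in> S. P x = False})" by blast
  moreover have "S \<subseteq> {x \<in> S. P x = True} \<union> {x \<in> S. P x = False}" by auto
  ultimately show False using assms finite_subset by blast
qed

text \<open>For a descending sequence of Mathias conditions: whatever the limit contains beyond the
  stem \<open>F k\<close> was taken from the reservoir \<open>S k\<close>.\<close>

lemma chain_bounds:
  assumes "\<And>j. S (Suc j) \<subseteq> S j" "\<And>j. F j \<subseteq> F (Suc j)" "\<And>j. F (Suc j) \<subseteq> F j \<union> S j"
  shows "(\<Union>j. F j) \<subseteq> F k \<union> S k" and "j \<le> k \<Longrightarrow> F j \<subseteq> F k"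
proof -
  have S: "S (k + d) \<subseteq> S k" for k d by (induction d) (use assms(1) in force)+
  show F: "j \<le> k \<Longrightarrow> F j \<subseteq> F k" for j k using lift_Suc_mono_le[of F] assms(2) by blast
  have *: "F (k + d) \<subseteq> F k \<union> S k" for d
  proof (induction d)
    case (Suc d)
    with assms(3)[of "k + d"] S[of k d] show ?case by auto
  qed auto
  show "(\<Union>j. F j) \<subseteq> F k \<union> S k"
  proof
    fix x assume "x \<in> (\<Union>j. F j)"
    then obtain j where "x \<in> F j" by blast
    then have "x \<in> F (k + j)" using F[of j "k + j"] by auto
    with * show "x \<in> F k \<union> S k" by blast
  qed
qed

section \<open>Seetapun's theorem with avoidance\<close>

locale decidable_coloring =
  fixes Z D :: "nat set" and c :: "nat \<Rightarrow> nat \<Rightarrow> bool"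
  assumes c: "decidable Z (\<lambda>z. c (pfst z) (psnd z))"
begin

lemma decidable_c: "computable (join Z S) f \<Longrightarrow> computable (join Z S) g \<Longrightarrow>
    decidable (join Z S) (\<lambda>x. c (f x) (g x))"
  by (rule decidable_comp2[OF decidable_reduce[OF c reducible_join1]])

lemma avoids_color:
  assumes "avoids Z D S" "infinite {y \<in> S. c x y = i}"
  shows "avoids Z D {y \<in> S. c x y = i}"
  by (rule avoids_filter[OF assms]) (intro decidable_intros decidable_c)

text \<open>For one \<open>x\<close> after the other the reservoir is cut down to a colour that
  occurs infinitely often with \<open>x\<close>. Such a cut is decidable from the reservoir, hence
  preserves avoidance.\<close>

lemma avoids_limit_colors:
  assumes "avoids Z D S"
  shows "\<exists>S'\<subseteq>S. avoids Z D S' \<and> (\<forall>y\<in>S'. k \<le> y) \<and> (\<forall>x<k. \<exists>i. \<forall>y\<in>S'. c x y = i)"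
proof (induction k)
  case 0 show ?case using assms by blast
next
  case (Suc k)
  then obtain S' where S': "S' \<subseteq> S" "avoids Z D S'" "\<forall>x<k. \<exists>i. \<forall>y\<in>S'. c x y = i" by blast
  have "infinite S'" using S'(2) unfolding avoids_def by blast
  from ex_infinite_color[OF this, of "c k"] obtain i where "infinite {y \<in> S'. c k y = i}" ..
  then have av: "avoids Z D {y \<in> {y \<in> S'. c k y = i}. Suc k \<le> y}" (is "avoids Z D ?S")
    by (intro avoids_above avoids_color S')
  have "\<exists>i. \<forall>y\<in>?S. c x y = i" if "x < Suc k" for x
  proof (cases "x = k")
    case True
    then show ?thesis by blast
  next
    case False
    with \<open>x < Suc k\<close> have "x < k" by simp
    with S'(3) obtain j where "\<forall>y\<in>S'. c x y = j" by blast
    then show ?thesis by blast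
  qed
  then have "\<forall>x<Suc k. \<exists>i. \<forall>y\<in>?S. c x y = i" by (intro allI impI)
  moreover have "?S \<subseteq> S" using S'(1) by blast
  moreover have "\<forall>y\<in>?S. Suc k \<le> y" by blast
  ultimately show ?case using av by (intro exI[of _ ?S] conjI)
qed

text \<open>Two stems, one per colour, share a reservoir. The last clause lets any finite
  homogeneous subset of the reservoir join the stem of its colour and keep it homogeneous.\<close>

definition condition :: "(bool \<Rightarrow> nat set) \<Rightarrow> nat set \<Rightarrow> bool" where
  "condition F S \<longleftrightarrow> avoids Z D S \<and>
    (\<forall>i. finite (F i) \<and> homogeneous c i (F i) \<and> (\<forall>x\<in>F i. \<forall>y\<in>S. x < y \<and> c x y = i))"

definition extends :: "(bool \<Rightarrow> nat set) \<Rightarrow> nat set \<Rightarrow> (bool \<Rightarrow> nat set) \<Rightarrow> nat set \<Rightarrow> bool" where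
  "extends F S F' S' \<longleftrightarrow> S' \<subseteq> S \<and> (\<forall>i. F i \<subseteq> F' i \<and> F' i \<subseteq> F i \<union> S)"

lemma extends_trans: "extends F S F' S' \<Longrightarrow> extends F' S' F'' S'' \<Longrightarrow> extends F S F'' S''"
  unfolding extends_def by blast

lemma condition_add:
  assumes "condition F S" "E \<subseteq> S" "finite E" "homogeneous c i E" "S' \<subseteq> S" "avoids Z D S'"
    and "\<And>x y. x \<in> E \<Longrightarrow> y \<in> S' \<Longrightarrow> x < y \<and> c x y = i"
  shows "condition (F(i := F i \<union> E)) S' \<and> extends F S (F(i := F i \<union> E)) S'"
proof
  have F: "finite (F j)" "homogeneous c j (F j)" "\<And>x y. x \<in> F j \<Longrightarrow> y \<in> S \<Longrightarrow> x < y \<and> c x y = j" for j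
    using assms(1) unfolding condition_def by blast+
  have "homogeneous c i (F i \<union> E)"
    unfolding homogeneous_def
  proof (intro ballI impI)
    fix x y assume xy: "x \<in> F i \<union> E" "y \<in> F i \<union> E" "x < y"
    \<comment> \<open>The last case is void, because stems lie below the reservoir.\<close>
    then consider "x \<in> F i" "y \<in> F i" | "x \<in> F i" "y \<in> S" | "x \<in> E" "y \<in> E" | "y \<in> F i" "x \<in> S"
      using assms(2) by blast
    then show "c x y = i"
      using F(2)[of i] F(3)[of x i y] F(3)[of y i x] assms(4) xy(3)
      unfolding homogeneous_def by cases (blast, blast, blast, simp)
  qed
  moreover have "x < y \<and> c x y = i" if "x \<in> F i \<union> E" "y \<in> S'" for x y
    using that F(3)[of x i y] assms(5,7) by blast
  ultimately show "condition (F(i := F i \<union> E)) S'"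
    using F assms(3,5,6) unfolding condition_def by (auto simp: subset_iff)
  show "extends F S (F(i := F i \<union> E)) S'" using assms(2,5) unfolding extends_def by auto
qed

lemma condition_restrict:
  assumes "condition F S" "S' \<subseteq> S" "avoids Z D S'"
  shows "condition F S'" "extends F S F S'"
  using assms unfolding condition_def extends_def by blast+

text \<open>The set \<open>Y\<close> splits the reservoir \<open>S\<close>; the part of colour \<open>i\<close> is \<open>S \<inter> Y\<close> for \<open>i = True\<close> and
  \<open>S - Y\<close> otherwise.\<close>

definition captures :: "bool \<Rightarrow> program \<Rightarrow> nat set \<Rightarrow> nat set \<Rightarrow> nat \<Rightarrow> nat \<Rightarrow> nat set \<Rightarrow> bool" where
  "captures i q F S n k Y \<longleftrightarrow> (\<exists>e<2 ^ k. (\<forall>x\<in>set_decode e. x \<in> S \<and> (x \<in> Y \<longleftrightarrow> i)) \<and>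
    homogeneous c i (set_decode e) \<and> (\<exists>s\<le>k. stage Z q n s (F \<union> set_decode e)))"

lemma decidable_captures:
  assumes "finite F" "computable (join Z S) f" "computable (join Z S) g" "computable (join Z S) h"
  shows "decidable (join Z S) (\<lambda>x. captures i q F S (f x) (g x) (set_decode (h x)))"
  unfolding captures_def homogeneous_def Un_def
  by (intro decidable_intros decidable_stage decidable_finite_set decidable_c
      decidable_reducible[OF reducible_join2] reducible_join1 assms computable_comp[OF assms(2)]
      computable_comp[OF assms(3)] computable_comp[OF assms(4)])

lemma finitary_captures: "finitary (captures i q F S n)"
  unfolding finitary_def
proof (intro allI impI)
  fix k and A A' :: "nat set" assume A: "A \<inter> {..<k} = A' \<inter> {..<k}"
  have "(\<forall>x\<in>set_decode e. x \<in> S \<and> (x \<in> A \<longleftrightarrow> i)) \<longleftrightarrow> (\<forall>x\<in>set_decode e. x \<in> S \<and> (x \<in> A' \<longleftrightarrow> i))"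
    if "e < 2 ^ k" for e
    using that A unfolding set_decode_subset_less[symmetric] by blast
  then show "captures i q F S n k A = captures i q F S n k A'"
    unfolding captures_def by blast
qed

text \<open>Seetapun's disjunction: two programs are treated together, one for each colour, and only
  one of them is defeated. It is asked whether every splitting of the reservoir has a part in which
  a finite homogeneous set forces \<open>n\<close>.\<close>

lemma condition_decide:
  assumes cond: "condition F S"
  shows "\<exists>F' S' i. condition F' S' \<and> extends F S F' S' \<and>
    (\<forall>G. F' i \<subseteq> G \<longrightarrow> G \<subseteq> F' i \<union> S' \<longrightarrow> homogeneous c i G \<longrightarrow> D \<noteq> {n. \<exists>s. stage Z (p i) n s G})"
proof -
  have F: "finite (F i)" for i using cond unfolding condition_def by blast
  have S: "avoids Z D S" using cond unfolding condition_def by blast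
  define U where "U n k Y \<longleftrightarrow> captures True (p True) (F True) S n k Y \<or>
    captures False (p False) (F False) S n k Y" for n k Y
  have U: "U n k Y \<longleftrightarrow> (\<exists>i. captures i (p i) (F i) S n k Y)" for n k Y
    unfolding U_def ex_bool_eq by blast
  have fU: "finitary (U n)" for n
    using finitary_captures unfolding finitary_def U_def by blast
  define Q where "Q = {n. \<exists>k. \<forall>a<2 ^ k. \<exists>s\<le>k. U n s (set_decode a)}"
  have Q: "n \<in> Q \<longleftrightarrow> (\<forall>Y. \<exists>s. U n s Y)" for n
    unfolding Q_def mem_Collect_eq Cantor_compactness_decode[OF fU] ..
  have "ce_in (join Z S) Q" unfolding Q_def U_def
    by (intro ce_inI decidable_intros decidable_captures F)
  with S have "Q \<noteq> D" unfolding avoids_def by blast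
  then consider n where "n \<in> Q" "n \<notin> D" | n where "n \<in> D" "n \<notin> Q" by blast
  then show ?thesis
  proof cases
    case 1
    \<comment> \<open>\<open>n\<close> is forced in every splitting. Compactness bounds the finite
      sets involved by \<open>k\<close>, so that fixing the limit colours below \<open>k\<close> is
      enough.\<close>
    have "\<exists>s. U n s Y" for Y using 1(1) unfolding Q by (rule spec)
    from Cantor_compactness[OF fU this] obtain k where k: "\<forall>Y. \<exists>s\<le>k. U n s Y" ..
    obtain S' where S': "S' \<subseteq> S" "avoids Z D S'" "\<forall>y\<in>S'. k \<le> y" "\<forall>x<k. \<exists>i. \<forall>y\<in>S'. c x y = i"
      using avoids_limit_colors[OF S, of k] by (elim exE conjE)
    define l where "l x \<longleftrightarrow> (\<exists>y\<in>S'. c x y)" for x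
    have l: "c x y = l x" if "x < k" "y \<in> S'" for x y
    proof -
      obtain i where "\<forall>y\<in>S'. c x y = i" using S'(4) \<open>x < k\<close> by blast
      with \<open>y \<in> S'\<close> show ?thesis unfolding l_def by blast
    qed
    \<comment> \<open>In the splitting by limit colours, the captured set has limit colour
      \<open>i\<close> throughout and can be added to the stem of colour \<open>i\<close>.\<close>
    obtain r where r: "r \<le> k" "U n r {x. l x}" using spec[OF k, of "{x. l x}"] by blast
    then obtain i where "captures i (p i) (F i) S n r {x. l x}" unfolding U by blast
    then obtain e s where e: "e < 2 ^ r" "\<And>x. x \<in> set_decode e \<Longrightarrow> x \<in> S \<and> l x = i"
      "homogeneous c i (set_decode e)" and s: "s \<le> r" "stage Z (p i) n s (F i \<union> set_decode e)"
      unfolding captures_def by blast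
    have "set_decode e \<subseteq> {..<r}" using e(1) set_decode_subset_less by blast
    then have below: "x < k" if "x \<in> set_decode e" for x using that r(1) by auto
    define F' where "F' = F(i := F i \<union> set_decode e)"
    have "condition F' S' \<and> extends F S F' S'" unfolding F'_def
    proof (rule condition_add[OF cond _ _ e(3) S'(1,2)])
      show "set_decode e \<subseteq> S" using e(2) by blast
      fix x y assume xy: "x \<in> set_decode e" "y \<in> S'"
      have "x < y" using below[OF xy(1)] S'(3) xy(2) by (meson less_le_trans)
      moreover have "c x y = i" using l[OF below[OF xy(1)] xy(2)] e(2)[OF xy(1)] by simp
      ultimately show "x < y \<and> c x y = i" ..
    qed simp
    moreover have "D \<noteq> {n. \<exists>s. stage Z (p i) n s G}" if "F' i \<subseteq> G" "G \<subseteq> F' i \<union> S'" for G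
    proof -
      \<comment> \<open>\<open>S'\<close> starts at \<open>k\<close>, so later additions cannot
        spoil the derivation coded by \<open>s\<close>.\<close>
      have "S' \<inter> {..<s} = {}" using S'(3) s(1) r(1) by fastforce
      with that have "G \<inter> {..<s} = (F i \<union> set_decode e) \<inter> {..<s}"
        unfolding F'_def by auto
      from stage_cong[OF this] s(2) have "stage Z (p i) n s G" by blast
      with 1(2) show ?thesis by blast
    qed
    ultimately show ?thesis by (intro exI[of _ F'] exI[of _ S'] exI[of _ i]) simp
  next
    case 2
    \<comment> \<open>The splittings in which no part forces \<open>n\<close> form a nonempty
      effectively closed class, which has a member \<open>Y\<close> that preserves
      avoidance.\<close>
    have "closed_class (join Z S) (\<lambda>k Y. \<not> U n k Y)" unfolding closed_class_def
    proof
      show "finitary (\<lambda>k Y. \<not> U n k Y)" using fU[of n] unfolding finitary_def by blast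
      show "decidable (join Z S) (\<lambda>z. \<not> U n (pfst z) (set_decode (psnd z)))"
        unfolding U_def by (intro decidable_intros decidable_captures F)
    qed
    moreover have "\<exists>Y. \<forall>k. \<not> U n k Y" using 2(2) unfolding Q by blast
    moreover have "\<not> ce_in (join Z S) D" using S unfolding avoids_def by blast
    ultimately have "\<exists>Y. (\<forall>k. \<not> U n k Y) \<and> \<not> ce_in (join (join Z S) Y) D"
      by (rule closed_class_avoidance)
    then obtain Y where Y: "\<forall>k. \<not> U n k Y" "\<not> ce_in (join (join Z S) Y) D"
      by (elim exE conjE)
    have "infinite S" using S unfolding avoids_def by blast
    \<comment> \<open>An infinite part of the splitting is computable from \<open>S\<close> and
      \<open>Y\<close> and becomes the new reservoir.\<close>
    from ex_infinite_color[OF this, of "\<lambda>x. x \<in> Y"]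
    obtain i where inf: "infinite {x \<in> S. (x \<in> Y) = i}" ..
    define S' where "S' = {x \<in> S. x \<in> Y \<longleftrightarrow> i}"
    have red: "turing_reducible Z (join (join Z S) Y)" "turing_reducible S (join (join Z S) Y)"
      by (rule turing_reducible_trans[OF reducible_join1 reducible_join1],
          rule turing_reducible_trans[OF reducible_join2 reducible_join1])
    have "turing_reducible S' (join (join Z S) Y)"
      unfolding turing_reducible_iff_decidable S'_def mem_Collect_eq
      by (intro decidable_intros decidable_reducible[OF red(2)] decidable_reducible[OF reducible_join2])
    then have "turing_reducible (join Z S') (join (join Z S) Y)"
      using red(1) by (intro join_reducible)
    from ce_in_reduce[OF _ this] have "\<not> ce_in (join Z S') D" using Y(2) by blast
    with inf have av: "avoids Z D S'" unfolding avoids_def S'_def ..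
    have sub: "S' \<subseteq> S" unfolding S'_def by blast
    have "D \<noteq> {n. \<exists>s. stage Z (p i) n s G}"
      if G: "F i \<subseteq> G" "G \<subseteq> F i \<union> S'" "homogeneous c i G" for G
    proof
      assume "D = {n. \<exists>s. stage Z (p i) n s G}"
      with 2(1) obtain s where s: "stage Z (p i) n s G" by blast
      \<comment> \<open>What \<open>G\<close> adds to the stem, cut off at the use \<open>s\<close>,
        would be captured in the splitting by \<open>Y\<close>.\<close>
      obtain e where e: "e < 2 ^ s" "set_decode e = (G - F i) \<inter> {..<s}" using ex_decode_Int by blast
      have "G \<inter> {..<s} = (F i \<union> set_decode e) \<inter> {..<s}" using G(1) e(2) by auto
      from stage_cong[OF this] s have "stage Z (p i) n s (F i \<union> set_decode e)" by blast
      moreover have "homogeneous c i (set_decode e)"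
        using G(3) by (rule homogeneous_subset) (use e(2) in blast)
      moreover have "\<forall>x\<in>set_decode e. x \<in> S \<and> (x \<in> Y \<longleftrightarrow> i)"
        using G(2) e(2) unfolding S'_def by blast
      ultimately have "captures i (p i) (F i) S n s Y" unfolding captures_def using e(1) by blast
      with Y(1) show False unfolding U by blast
    qed
    with condition_restrict[OF cond sub av] show ?thesis
      by (intro exI[of _ F] exI[of _ S'] exI[of _ i]) simp
  qed
qed

lemma condition_grow:
  assumes "condition F S" "infinite {y \<in> S. c x y = i}" "x \<in> S"
  shows "\<exists>F' S'. condition F' S' \<and> extends F S F' S' \<and> F i \<subset> F' i"
proof -
  have S: "avoids Z D S" using assms(1) unfolding condition_def by blast
  let ?S = "{y \<in> {y \<in> S. c x y = i}. Suc x \<le> y}"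
  have "condition (F(i := F i \<union> {x})) ?S \<and> extends F S (F(i := F i \<union> {x})) ?S"
  proof (rule condition_add[OF assms(1)])
    show "avoids Z D ?S" by (intro avoids_above avoids_color S assms(2))
    show "homogeneous c i {x}" unfolding homogeneous_def by blast
  qed (use assms(3) in auto)
  moreover have "x \<notin> F i" using assms(1,3) unfolding condition_def by blast
  then have "F i \<subset> (F(i := F i \<union> {x})) i" by auto
  ultimately show ?thesis by blast
qed

definition diagonal :: "program \<Rightarrow> bool \<Rightarrow> (bool \<Rightarrow> nat set) \<Rightarrow> nat set \<Rightarrow> bool" where
  "diagonal q i F S \<longleftrightarrow> (\<forall>G. F i \<subseteq> G \<longrightarrow> G \<subseteq> F i \<union> S \<longrightarrow> homogeneous c i G \<longrightarrow>
    D \<noteq> {n. \<exists>s. stage Z q n s G})"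

text \<open>Grow both stems, then decide. The first growth shrinks the reservoir, which is why
  \<open>nolim\<close> speaks of all smaller avoiding reservoirs.\<close>

lemma condition_step:
  assumes cond: "condition F S"
    and nolim: "\<And>S' i. S' \<subseteq> S \<Longrightarrow> avoids Z D S' \<Longrightarrow> \<exists>x\<in>S'. infinite {y \<in> S'. c x y = i}"
  shows "\<exists>F' S'. condition F' S' \<and> extends F S F' S' \<and> (\<forall>i. F i \<subset> F' i) \<and> (\<exists>i. diagonal (p i) i F' S')"
proof -
  have grow: "\<exists>F'' S''. condition F'' S'' \<and> extends F' S' F'' S'' \<and> F' i \<subset> F'' i"
    if "condition F' S'" "S' \<subseteq> S" for F' S' i
  proof -
    have "avoids Z D S'" using that(1) unfolding condition_def by blast
    from nolim[OF that(2) this, of i] obtain x where "x \<in> S'" "infinite {y \<in> S'. c x y = i}" ..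
    with condition_grow[OF that(1)] show ?thesis by blast
  qed
  obtain F1 S1 where 1: "condition F1 S1" "extends F S F1 S1" "F True \<subset> F1 True"
    using grow[OF cond subset_refl, of True] by (elim exE conjE)
  have "S1 \<subseteq> S" using 1(2) unfolding extends_def by blast
  from grow[OF 1(1) this, of False]
  obtain F2 S2 where 2: "condition F2 S2" "extends F1 S1 F2 S2" "F1 False \<subset> F2 False"
    by (elim exE conjE)
  obtain F3 S3 i where 3: "condition F3 S3" "extends F2 S2 F3 S3" "diagonal (p i) i F3 S3"
    using condition_decide[OF 2(1), of p] unfolding diagonal_def by (elim exE conjE)
  have sub: "F j \<subseteq> F1 j" "F1 j \<subseteq> F2 j" "F2 j \<subseteq> F3 j" for j
    using 1(2) 2(2) 3(2) unfolding extends_def by simp_all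
  have "F True \<subset> F3 True"
    by (rule psubset_subset_trans[OF psubset_subset_trans[OF 1(3) sub(2)] sub(3)])
  moreover have "F False \<subset> F3 False"
    by (rule subset_psubset_trans[OF sub(1) psubset_subset_trans[OF 2(3) sub(3)]])
  ultimately have "\<forall>j. F j \<subset> F3 j" unfolding all_bool_eq ..
  moreover have "extends F S F3 S3" by (rule extends_trans[OF extends_trans[OF 1(2) 2(2)] 3(2)])
  ultimately show ?thesis using 3(1,3) by (intro exI[of _ F3] exI[of _ S3]) (intro conjI exI)
qed

lemma ex_homogeneous_avoids_if_no_limit:
  assumes R: "avoids Z D R"
    and nolim: "\<And>S i. S \<subseteq> R \<Longrightarrow> avoids Z D S \<Longrightarrow> \<exists>x\<in>S. infinite {y \<in> S. c x y = i}"
  shows "\<exists>H\<subseteq>R. avoids Z D H \<and> (\<exists>i. homogeneous c i H)"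
proof -
  \<comment> \<open>Stage \<open>n\<close> stands for a pair of programs, one for each
    colour.\<close>
  define p where "p n i = nth_program (if i then pfst n else psnd n)" for n i
  let ?P = "\<lambda>(n :: nat) t. condition (fst t) (snd t) \<and> snd t \<subseteq> R \<and> (\<forall>i. fst t i \<subseteq> R)"
  let ?Q = "\<lambda>n t t'. extends (fst t) (snd t) (fst t') (snd t') \<and> (\<forall>i. fst t i \<subset> fst t' i) \<and>
    (\<exists>i. diagonal (p n i) i (fst t') (snd t'))"
  have "\<exists>f. \<forall>n. ?P n (f n) \<and> ?Q n (f n) (f (Suc n))"
  proof (rule dependent_nat_choice)
    show "\<exists>t. ?P 0 t"
      using R by (intro exI[of _ "(\<lambda>_. {}, R)"]) (simp add: condition_def homogeneous_def)
  next
    fix t n assume t: "?P n t"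
    have "\<exists>x\<in>S'. infinite {y \<in> S'. c x y = i}" if "S' \<subseteq> snd t" "avoids Z D S'" for S' i
      using nolim[OF _ that(2)] that(1) t by blast
    with t obtain F' S' where *: "condition F' S'" "extends (fst t) (snd t) F' S'"
      "\<forall>i. fst t i \<subset> F' i" "\<exists>i. diagonal (p n i) i F' S'"
      using condition_step[of "fst t" "snd t" "p n"] by (elim conjE) blast
    then have "S' \<subseteq> R" "\<forall>i. F' i \<subseteq> R" using t unfolding extends_def by blast+
    with * show "\<exists>t'. ?P (Suc n) t' \<and> ?Q n t t'" by (intro exI[of _ "(F', S')"]) simp
  qed
  then obtain f where f: "\<forall>n. ?P n (f n) \<and> ?Q n (f n) (f (Suc n))" ..
  define F S where "F n = fst (f n)" and "S n = snd (f n)" for n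
  have cond: "condition (F n) (S n)" and R': "F n i \<subseteq> R" and ext: "extends (F n) (S n) (F (Suc n)) (S (Suc n))"
    and grow: "F n i \<subset> F (Suc n) i" and diag: "\<exists>i. diagonal (p n i) i (F (Suc n)) (S (Suc n))" for n i
    using spec[OF f, of n] unfolding F_def S_def by blast+
  define G where "G i = (\<Union>n. F n i)" for i
  have ext': "S (Suc n) \<subseteq> S n" "F n i \<subseteq> F (Suc n) i" "F (Suc n) i \<subseteq> F n i \<union> S n" for n i
    using ext[of n] unfolding extends_def by blast+
  have G: "G i \<subseteq> F k i \<union> S k" for i k
    unfolding G_def by (rule chain_bounds(1)[of S "\<lambda>n. F n i", OF ext'])
  have mono: "j \<le> k \<Longrightarrow> F j i \<subseteq> F k i" for i j k
    by (rule chain_bounds(2)[of S "\<lambda>n. F n i", OF ext'])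
  have hom: "homogeneous c i (G i)" for i
    unfolding homogeneous_def
  proof (intro ballI impI)
    fix x y assume xy: "x \<in> G i" "y \<in> G i" "x < y"
    then obtain j k where "x \<in> F j i" "y \<in> F k i" unfolding G_def by blast
    then have "x \<in> F (max j k) i" "y \<in> F (max j k) i"
      using mono[of j "max j k" i] mono[of k "max j k" i] by auto
    with xy(3) cond[of "max j k"] show "c x y = i" unfolding condition_def homogeneous_def by blast
  qed
  have inf: "infinite (G i)" for i
  proof
    assume fin: "finite (G i)"
    have "n \<le> card (F n i)" for n
    proof (induction n)
      case (Suc n)
      have "finite (F (Suc n) i)" using cond unfolding condition_def by blast
      from psubset_card_mono[OF this grow] Suc show ?case by simp
    qed simp
    from this[of "Suc (card (G i))"] have "card (G i) < card (F (Suc (card (G i))) i)" by simp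
    moreover have "F (Suc (card (G i))) i \<subseteq> G i" unfolding G_def by blast
    ultimately show False using card_mono[OF fin] by (simp add: not_less[symmetric])
  qed
  have "\<exists>i. \<not> ce_in (join Z (G i)) D"
  proof (rule ccontr)
    assume "\<not> ?thesis"
    then have "\<exists>q. D = {n. \<exists>s. stage Z q n s (G i)}" for i using ce_in_join_stage by simp
    then obtain q where q: "D = {n. \<exists>s. stage Z (q i) n s (G i)}" for i by metis
    \<comment> \<open>If both limits enumerated \<open>D\<close>, the stage for the two programs
      responsible would have defeated one of them.\<close>
    define n where "n = prod_encode (program_code (q True), program_code (q False))"
    have "p n i = q i" for i unfolding p_def n_def by (cases i) simp_all
    with diag[of n] obtain i where "diagonal (q i) i (F (Suc n)) (S (Suc n))" by auto
    moreover have "F (Suc n) i \<subseteq> G i" unfolding G_def by blast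
    ultimately show False using G hom q[of i] unfolding diagonal_def by blast
  qed
  then obtain i where "\<not> ce_in (join Z (G i)) D" ..
  with inf have "avoids Z D (G i)" unfolding avoids_def by blast
  moreover have "G i \<subseteq> R" using R' unfolding G_def by blast
  ultimately show ?thesis using hom by blast
qed

text \<open>If some avoiding subset of \<open>R\<close> has the same limit colour at all its points,
  thinning it is effective. Otherwise both stems can always be extended and forcing applies.\<close>

lemma ex_homogeneous_avoids:
  assumes R: "avoids Z D R"
  shows "\<exists>H\<subseteq>R. avoids Z D H \<and> (\<exists>i. homogeneous c i H)"
proof (cases "\<exists>S i. S \<subseteq> R \<and> avoids Z D S \<and> (\<forall>x\<in>S. finite {y \<in> S. \<not> (c x y = i)})")
  case True
  then obtain S i where S: "S \<subseteq> R" "avoids Z D S" and lim: "\<forall>x\<in>S. finite {y \<in> S. \<not> (c x y = i)}"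
    by (elim exE conjE)
  have fin: "finite {y \<in> S. \<not> (c x y = i)}" if "x \<in> S" for x using lim that by (rule bspec)
  have "infinite S" using S(2) unfolding avoids_def by blast
  have "decidable (join Z S) (\<lambda>z. c (pfst z) (psnd z) = i)"
    by (intro decidable_intros decidable_c)
  from this reducible_join2 \<open>infinite S\<close> fin
  have "\<exists>H\<subseteq>S. infinite H \<and> turing_reducible H (join Z S) \<and> (\<forall>x\<in>H. \<forall>y\<in>H. x < y \<longrightarrow> c x y = i)"
    by (rule thin_homogeneous[of "join Z S" "\<lambda>x y. c x y = i"])
  then obtain H where H: "H \<subseteq> S" "infinite H" "turing_reducible H (join Z S)"
    "\<forall>x\<in>H. \<forall>y\<in>H. x < y \<longrightarrow> c x y = i"
    by (elim exE conjE)
  then have "avoids Z D H" using avoids_reducible[OF S(2)] by blast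
  moreover have "homogeneous c i H" using H(4) unfolding homogeneous_def .
  ultimately show ?thesis using H(1) S(1) by (intro exI[of _ H]) blast
next
  case False
  have "\<exists>x\<in>S. infinite {y \<in> S. c x y = i}" if "S \<subseteq> R" "avoids Z D S" for S i
  proof (rule ccontr)
    \<comment> \<open>If no point has infinitely many partners of colour \<open>i\<close>, the
      opposite colour is the limit at every point.\<close>
    have eq: "{y \<in> S. \<not> (c x y = (\<not> i))} = {y \<in> S. c x y = i}" for x by blast
    assume "\<not> ?thesis"
    then have "\<forall>x\<in>S. finite {y \<in> S. \<not> (c x y = (\<not> i))}" unfolding eq by simp
    with that have "\<exists>S i. S \<subseteq> R \<and> avoids Z D S \<and> (\<forall>x\<in>S. finite {y \<in> S. \<not> (c x y = i)})"
      by (intro exI conjI)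
    with False show False ..
  qed
  with R show ?thesis by (rule ex_homogeneous_avoids_if_no_limit)
qed

end

section \<open>Sets cohesive for countably many colorings\<close>

lemma avoids_UNIV:
  assumes "\<not> ce_in Z D"
  shows "avoids Z D UNIV"
proof -
  have "turing_reducible (join Z UNIV) Z"
    by (intro join_reducible turing_reducible_refl)
      (simp add: turing_reducible_iff_decidable decidable_const)
  with assms show ?thesis using ce_in_reduce unfolding avoids_def by blast
qed

text \<open>Here any finite subset of the reservoir may be added to the stem, so the forcing
  question is a plain search and compactness does not enter.\<close>

lemma Mathias_decide:
  assumes F: "finite F" and S: "avoids Z D S"
  shows "\<exists>E S'. finite E \<and> E \<subseteq> S \<and> S' \<subseteq> S \<and> avoids Z D S' \<and> (\<forall>x\<in>E. \<forall>y\<in>S'. x < y) \<and>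
    (\<forall>G. F \<union> E \<subseteq> G \<longrightarrow> G \<subseteq> F \<union> E \<union> S' \<longrightarrow> D \<noteq> {n. \<exists>s. stage Z p n s G})"
proof -
  define Q where "Q = {n. \<exists>w. (\<forall>x\<in>set_decode (pfst w). x \<in> S) \<and>
    stage Z p n (psnd w) {u. u \<in> F \<or> u \<in> set_decode (pfst w)}}"
  have Q: "n \<in> Q \<longleftrightarrow> (\<exists>e s. set_decode e \<subseteq> S \<and> stage Z p n s (F \<union> set_decode e))" for n
  proof
    assume "n \<in> Q"
    then show "\<exists>e s. set_decode e \<subseteq> S \<and> stage Z p n s (F \<union> set_decode e)"
      unfolding Q_def Un_def by blast
  next
    assume "\<exists>e s. set_decode e \<subseteq> S \<and> stage Z p n s (F \<union> set_decode e)"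
    then obtain e s where "set_decode e \<subseteq> S" "stage Z p n s (F \<union> set_decode e)" by blast
    then show "n \<in> Q"
      unfolding Q_def Un_def by (intro CollectI exI[of _ "prod_encode (e, s)"]) auto
  qed
  have "ce_in (join Z S) Q" unfolding Q_def
    by (intro ce_inI decidable_intros decidable_stage decidable_finite_set F reducible_join1
        decidable_reducible[OF reducible_join2])
  with S have "Q \<noteq> D" unfolding avoids_def by blast
  then consider n where "n \<in> Q" "n \<notin> D" | n where "n \<in> D" "n \<notin> Q" by blast
  then show ?thesis
  proof cases
    case 1
    then obtain e s where e: "set_decode e \<subseteq> S" and s: "stage Z p n s (F \<union> set_decode e)"
      unfolding Q by blast
    \<comment> \<open>Starting above \<open>s\<close> protects the derivation; starting above
      \<open>e\<close> puts the reservoir beyond all elements of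
      \<open>set_decode e\<close>.\<close>
    let ?S = "{y \<in> S. s + e \<le> y}"
    have "D \<noteq> {n. \<exists>s. stage Z p n s G}"
      if "F \<union> set_decode e \<subseteq> G" "G \<subseteq> F \<union> set_decode e \<union> ?S" for G
    proof -
      have "G \<inter> {..<s} = (F \<union> set_decode e) \<inter> {..<s}" using that by auto
      from stage_cong[OF this] s have "stage Z p n s G" by blast
      with 1(2) show ?thesis by blast
    qed
    moreover have "\<forall>x\<in>set_decode e. \<forall>y\<in>?S. x < y" using set_decode_less by fastforce
    moreover have "avoids Z D ?S" by (rule avoids_above[OF S])
    ultimately show ?thesis
      using e by (intro exI[of _ "set_decode e"] exI[of _ ?S]) simp
  next
    case 2
    \<comment> \<open>No finite subset of the reservoir forces \<open>n\<close>, so the condition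
      itself already keeps \<open>n\<close> out.\<close>
    have "D \<noteq> {n. \<exists>s. stage Z p n s G}" if G: "F \<subseteq> G" "G \<subseteq> F \<union> S" for G
    proof
      assume "D = {n. \<exists>s. stage Z p n s G}"
      with 2(1) obtain s where s: "stage Z p n s G" by blast
      obtain e where e: "set_decode e = (G - F) \<inter> {..<s}" using ex_decode_Int by blast
      have "G \<inter> {..<s} = (F \<union> set_decode e) \<inter> {..<s}" using G(1) e by auto
      from stage_cong[OF this] s have "stage Z p n s (F \<union> set_decode e)" by blast
      moreover have "set_decode e \<subseteq> S" using e G(2) by blast
      ultimately show False using 2(2) unfolding Q by blast
    qed
    with S show ?thesis by (intro exI[of _ "{}"] exI[of _ S]) simp
  qed
qed

text \<open>Stage \<open>n\<close> makes the reservoir homogeneous for \<open>c n\<close>, puts a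
  new element into the stem and defeats the program with index \<open>n\<close>.\<close>

lemma ex_cohesive_avoids:
  fixes c :: "nat \<Rightarrow> nat \<Rightarrow> nat \<Rightarrow> bool"
  assumes c: "\<And>j. decidable Z (\<lambda>z. c j (pfst z) (psnd z))" and D: "\<not> ce_in Z D"
  shows "\<exists>A. avoids Z D A \<and> (\<forall>j. \<exists>F i. finite F \<and> homogeneous (c j) i (A - F))"
proof -
  let ?P = "\<lambda>(n :: nat) t. finite (fst t) \<and> avoids Z D (snd t) \<and> (\<forall>x\<in>fst t. \<forall>y\<in>snd t. x < y)"
  let ?Q = "\<lambda>n t t'. snd t' \<subseteq> snd t \<and> fst t \<subset> fst t' \<and> fst t' \<subseteq> fst t \<union> snd t \<and>
    (\<exists>i. homogeneous (c n) i (snd t')) \<and>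
    (\<forall>G. fst t' \<subseteq> G \<longrightarrow> G \<subseteq> fst t' \<union> snd t' \<longrightarrow> D \<noteq> {m. \<exists>s. stage Z (nth_program n) m s G})"
  have "\<exists>f. \<forall>n. ?P n (f n) \<and> ?Q n (f n) (f (Suc n))"
  proof (rule dependent_nat_choice)
    show "\<exists>t. ?P 0 t"
      using avoids_UNIV[OF D] by (intro exI[of _ "({}, UNIV)"]) simp
  next
    fix t n assume t: "?P n t"
    obtain F S where FS: "t = (F, S)" by (cases t)
    have F: "finite F" and S: "avoids Z D S" and FS_less: "\<And>x y. x \<in> F \<Longrightarrow> y \<in> S \<Longrightarrow> x < y"
      using t unfolding FS by auto
    interpret decidable_coloring Z D "c n" using c by unfold_locales
    obtain S1 i where S1: "S1 \<subseteq> S" "avoids Z D S1" "homogeneous (c n) i S1"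
      using ex_homogeneous_avoids[OF S] by (elim exE conjE)
    then have "infinite S1" unfolding avoids_def by blast
    \<comment> \<open>This element makes the limit infinite, as the extension \<open>E\<close>
      obtained below may be empty.\<close>
    then obtain x where x: "x \<in> S1" using infinite_imp_nonempty by blast
    have S2: "avoids Z D {y \<in> S1. Suc x \<le> y}" by (rule avoids_above[OF S1(2)])
    have "finite (insert x F)" using F by simp
    from Mathias_decide[OF this S2, of "nth_program n"]
    obtain E S' where E: "finite E" "E \<subseteq> {y \<in> S1. Suc x \<le> y}" "S' \<subseteq> {y \<in> S1. Suc x \<le> y}"
      "avoids Z D S'" "\<forall>x\<in>E. \<forall>y\<in>S'. x < y"
      and diag: "\<forall>G. insert x F \<union> E \<subseteq> G \<longrightarrow> G \<subseteq> insert x F \<union> E \<union> S' \<longrightarrow>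
        D \<noteq> {m. \<exists>s. stage Z (nth_program n) m s G}"
      by (elim exE conjE)
    have "x \<notin> F" using FS_less[of x x] x S1(1) by blast
    then have "F \<subset> insert x F \<union> E" by blast
    moreover have "insert x F \<union> E \<subseteq> F \<union> S" using x S1(1) E(2) by blast
    moreover have "S' \<subseteq> S" using E(3) S1(1) by blast
    moreover have "homogeneous (c n) i S'" using S1(3) by (rule homogeneous_subset) (use E(3) in blast)
    moreover have "\<forall>z\<in>insert x F \<union> E. \<forall>y\<in>S'. z < y"
    proof (intro ballI)
      fix z y assume "z \<in> insert x F \<union> E" and y: "y \<in> S'"
      then consider "z = x" | "z \<in> F" | "z \<in> E" by blast
      then show "z < y"
      proof cases
        case 1 then show ?thesis using y E(3) by auto
      next
        case 2 then show ?thesis using FS_less \<open>S' \<subseteq> S\<close> y by blast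
      next
        case 3 then show ?thesis using y E(5) by blast
      qed
    qed
    ultimately show "\<exists>t'. ?P (Suc n) t' \<and> ?Q n t t'"
      using E(1,4) F diag unfolding FS by (intro exI[of _ "(insert x F \<union> E, S')"]) auto
  qed
  then obtain f where f: "\<forall>n. ?P n (f n) \<and> ?Q n (f n) (f (Suc n))" ..
  define F S where "F n = fst (f n)" and "S n = snd (f n)" for n
  have fin: "finite (F n)" and S: "S (Suc n) \<subseteq> S n" and grow: "F n \<subset> F (Suc n)"
    and FS: "F (Suc n) \<subseteq> F n \<union> S n" and hom: "\<exists>i. homogeneous (c n) i (S (Suc n))"
    and diag: "\<forall>G. F (Suc n) \<subseteq> G \<longrightarrow> G \<subseteq> F (Suc n) \<union> S (Suc n) \<longrightarrow>
      D \<noteq> {m. \<exists>s. stage Z (nth_program n) m s G}" for n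
    using spec[OF f, of n] unfolding F_def S_def by - (elim conjE, assumption)+
  define A where "A = (\<Union>n. F n)"
  have A: "A \<subseteq> F k \<union> S k" for k
    unfolding A_def by (rule chain_bounds(1)[of S F, OF S psubset_imp_subset[OF grow] FS])
  have "infinite A"
  proof
    assume finA: "finite A"
    have "n \<le> card (F n)" for n
    proof (induction n)
      case (Suc n)
      from psubset_card_mono[OF fin grow[of n]] Suc show ?case by simp
    qed simp
    from this[of "Suc (card A)"] have "card A < card (F (Suc (card A)))" by simp
    moreover have "F (Suc (card A)) \<subseteq> A" unfolding A_def by blast
    ultimately show False using card_mono[OF finA] by (simp add: not_less[symmetric])
  qed
  moreover have "\<not> ce_in (join Z A) D"
  proof
    assume "ce_in (join Z A) D"
    then obtain p where "D = {n. \<exists>s. stage Z p n s A}" using ce_in_join_stage by blast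
    moreover have "F (Suc (program_code p)) \<subseteq> A" unfolding A_def by blast
    ultimately show False
      using spec[OF diag[of "program_code p"], of A] A[of "Suc (program_code p)"] by simp
  qed
  moreover have "\<exists>F i. finite F \<and> homogeneous (c j) i (A - F)" for j
  proof -
    obtain i where "homogeneous (c j) i (S (Suc j))" using hom by blast
    then have "homogeneous (c j) i (A - F (Suc j))"
      by (rule homogeneous_subset) (use A[of "Suc j"] in blast)
    with fin show ?thesis by blast
  qed
  ultimately show ?thesis unfolding avoids_def by blast
qed

section \<open>Every 2-cohesive set computes the halting set\<close>

lemma pair_in_nsets2: "x \<in> A \<Longrightarrow> y \<in> A \<Longrightarrow> x < y \<Longrightarrow> {x, y} \<in> [A]\<^bsup>2\<^esup>" for x y :: nat
  by (simp add: nsets_def)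

lemma nsets2_cases:
  fixes A :: "nat set"
  assumes "s \<in> [A]\<^bsup>2\<^esup>"
  obtains x y where "s = {x, y}" "x < y" "x \<in> A" "y \<in> A"
proof -
  obtain x y where xy: "s = {x, y}" "x \<noteq> y" "s \<subseteq> A"
    using assms unfolding nsets_def by (auto simp: card_2_iff)
  then consider "x < y" | "y < x" by linarith
  then show thesis
  proof cases
    case 1 with xy that show ?thesis by blast
  next
    case 2 with xy that[of y x] show ?thesis by blast
  qed
qed

lemma halting_set_reducible_if_two_cohesive:
  assumes "two_cohesive A"
  shows "turing_reducible halting_set A"
proof -
  obtain H where H: "decidable {} (\<lambda>z. H (pfst z) (psnd z))" and K: "halting_set = {k. \<exists>s. H k s}"
    using ce_in_halting_set by (rule ce_inE)
  define Q where "Q x y \<longleftrightarrow> (\<exists>k<x. (\<exists>s. H k s) \<and> \<not> (\<exists>s<y. H k s))" for x y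
  \<comment> \<open>\<open>Min\<close> and \<open>Max\<close> recover the ordered pair from the
    two-element set.\<close>
  define C :: "nat set \<Rightarrow> nat" where "C e = of_bool (Q (Min e) (Max e))" for e
  have C: "C {x, y} = of_bool (Q x y)" if "x < y" for x y
    using that by (simp add: C_def)
  \<comment> \<open>The only unbounded quantifier, over halting witnesses, moves to the front;
    colour 1 is therefore enumerable.\<close>
  have "color_class C 1 = {z. \<exists>s. pfst z < psnd z \<and> (\<exists>k<pfst z. H k s \<and> \<not> (\<exists>t<psnd z. H k t))}"
    (is "_ = ?W")
  proof (rule set_eqI)
    fix z
    have "z \<in> color_class C 1 \<longleftrightarrow> pfst z < psnd z \<and> C {pfst z, psnd z} = 1"
      unfolding color_class_def mem_Collect_eq by (metis encode_pfst_psnd pfst_encode psnd_encode)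
    also have "\<dots> \<longleftrightarrow> pfst z < psnd z \<and> Q (pfst z) (psnd z)"
      using C[of "pfst z" "psnd z"] by (cases "Q (pfst z) (psnd z)") auto
    also have "\<dots> \<longleftrightarrow> z \<in> ?W" unfolding Q_def by blast
    finally show "z \<in> color_class C 1 \<longleftrightarrow> z \<in> ?W" .
  qed
  moreover have "ce_in {} ?W"
    by (intro ce_inI decidable_intros decidable_comp2[OF H])
  ultimately have "computably_enumerable (color_class C 1)"
    by (simp only: ce_in_imp_computably_enumerable)
  moreover have "two_coloring C" by (simp add: two_coloring_def C_def)
  ultimately have "ce_coloring C" unfolding ce_coloring_def by blast
  with assms obtain F i where F: "finite F" and hom: "\<And>s. s \<in> [A - F]\<^bsup>2\<^esup> \<Longrightarrow> C s = i"
    and inf: "infinite A"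
    unfolding two_cohesive_def almost_homogeneous_def by blast
  define B where "B = A - F"
  have infB: "infinite B" using inf F by (simp add: B_def)
  have unbounded: "\<exists>y\<in>B. m < y" for m
    using infB by (auto simp: infinite_nat_iff_unbounded)
  obtain x0 where x0: "x0 \<in> B" using unbounded by blast
  define f where "f k = (SOME s. H k s)" for k
  have f: "H k (f k)" if "\<exists>s. H k s" for k
    unfolding f_def using that by (rule someI_ex)
  \<comment> \<open>\<open>y0\<close> exceeds a witness for each \<open>k < x0\<close> in the
    halting set, so this pair has colour 0, and with it every pair from \<open>B\<close>.\<close>
  obtain y0 where y0: "y0 \<in> B" "x0 + (\<Sum>k<x0. f k) < y0" using unbounded by blast
  have "\<exists>s<y0. H k s" if "k < x0" "\<exists>s. H k s" for k
  proof (intro exI conjI)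
    have "f k \<le> (\<Sum>k<x0. f k)" using that(1) by (intro member_le_sum) auto
    then show "f k < y0" using y0(2) by linarith
  qed (rule f[OF that(2)])
  then have "\<not> Q x0 y0" unfolding Q_def by blast
  moreover have "x0 < y0" using y0 by linarith
  ultimately have "i = 0"
    using hom[OF pair_in_nsets2[of x0 _ y0]] C[of x0 y0] x0 y0(1) by (simp add: B_def)
  then have nQ: "\<not> Q x y" if "x \<in> B" "y \<in> B" "x < y" for x y
    using hom[OF pair_in_nsets2[of x _ y]] C[of x y] that by (simp add: B_def split: if_splits)
  \<comment> \<open>A pair of colour 0 from \<open>B\<close> above \<open>k\<close> refutes halting
    if no witness lies below its larger element. The finite set \<open>F\<close> is hard-wired, so
    this can be checked from \<open>A\<close>.\<close>
  have "- halting_set = {k. \<exists>w. k < pfst w \<and> pfst w < psnd w \<and> (pfst w \<in> A \<and> pfst w \<notin> F) \<and>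
      (psnd w \<in> A \<and> psnd w \<notin> F) \<and> \<not> (\<exists>s<psnd w. H k s)}" (is "_ = ?N")
  proof (intro set_eqI iffI)
    fix k assume k: "k \<in> - halting_set"
    obtain x y where "x \<in> B" "k < x" "y \<in> B" "x < y" using unbounded by meson
    with k show "k \<in> ?N"
      unfolding K B_def by (intro CollectI exI[of _ "prod_encode (x, y)"]) simp
  next
    fix k assume "k \<in> ?N"
    then obtain w where w: "k < pfst w" "pfst w < psnd w" "pfst w \<in> B" "psnd w \<in> B"
      "\<not> (\<exists>s<psnd w. H k s)"
      unfolding B_def by blast
    then have "\<not> (\<exists>s. H k s)" using nQ[of "pfst w" "psnd w"] unfolding Q_def by blast
    then show "k \<in> - halting_set" unfolding K by blast
  qed
  moreover have empty: "turing_reducible {} A"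
    unfolding turing_reducible_iff_decidable empty_iff by (rule decidable_const)
  have "ce_in A ?N"
    by (intro ce_inI decidable_intros decidable_comp2[OF decidable_reduce[OF H empty]]
        decidable_oracle decidable_finite_set F)
  ultimately have "ce_in A (- halting_set)" by (simp only:)
  with ce_in_reduce[OF ce_in_halting_set empty] show ?thesis by (rule reducible_if_ce_in_both)
qed

text \<open>Every c.e. set is decidable in the halting set, so reading each c.e. set as a set of
  pairs gives countably many colorings that cover all c.e. ones.\<close>

lemma ex_two_cohesive_avoids:
  assumes "\<not> ce_in halting_set D"
  shows "\<exists>A. two_cohesive A \<and> \<not> ce_in (join halting_set A) D"
proof -
  define W where "W j = {x. \<exists>y. computes {} (nth_program j) x y}" for j
  have "turing_reducible (W j) halting_set" for j
    by (rule reducible_halting_set_if_computably_enumerable)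
      (unfold computably_enumerable_def W_def, blast)
  then have "decidable halting_set (\<lambda>z. prod_encode (pfst z, psnd z) \<in> W j)" for j
    unfolding encode_pfst_psnd turing_reducible_iff_decidable .
  from ex_cohesive_avoids[of halting_set "\<lambda>j x y. prod_encode (x, y) \<in> W j", OF this assms]
  obtain A where A: "avoids halting_set D A"
    and hom: "\<forall>j. \<exists>F i. finite F \<and> homogeneous (\<lambda>x y. prod_encode (x, y) \<in> W j) i (A - F)"
    by (elim exE conjE)
  have "almost_homogeneous A C" if C: "ce_coloring C" for C
  proof -
    obtain k where k: "k \<in> {0, 1}" "computably_enumerable (color_class C k)" and C2: "two_coloring C"
      using C unfolding ce_coloring_def by blast
    then obtain p where p: "color_class C k = {x. \<exists>y. computes {} p x y}"
      unfolding computably_enumerable_def by blast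
    have W: "color_class C k = W (program_code p)" unfolding W_def p by simp
    obtain F i where F: "finite F"
      and i: "homogeneous (\<lambda>x y. prod_encode (x, y) \<in> color_class C k) i (A - F)"
      using spec[OF hom, of "program_code p"] unfolding W by (elim exE conjE)
    \<comment> \<open>With only two colours, a pair outside the enumerated class has colour
      \<open>1 - k\<close>.\<close>
    have "C s = (if i then k else 1 - k)" if "s \<in> [A - F]\<^bsup>2\<^esup>" for s
    proof -
      obtain x y where s: "s = {x, y}" "x < y" "x \<in> A - F" "y \<in> A - F"
        using \<open>s \<in> [A - F]\<^bsup>2\<^esup>\<close> by (rule nsets2_cases)
      then have "prod_encode (x, y) \<in> color_class C k \<longleftrightarrow> i"
        using i unfolding homogeneous_def by blast
      moreover have "prod_encode (x, y) \<in> color_class C k \<longleftrightarrow> C s = k"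
        using s(1,2) unfolding color_class_def by simp
      moreover have "C s \<in> {0, 1}"
        using C2 pair_in_nsets2[of x UNIV y] s(1,2) unfolding two_coloring_def by (simp add: Pi_iff)
      ultimately show ?thesis using k(1) by auto
    qed
    with F show ?thesis unfolding almost_homogeneous_def by blast
  qed
  with A show ?thesis unfolding avoids_def two_cohesive_def by blast
qed

theorem theorem3p11:
  fixes d :: turing_degree
  shows "(\<forall>A. two_cohesive A \<longrightarrow> d \<le> degree_of A) \<longleftrightarrow> d \<le> zero_jump"
proof
  assume below: "\<forall>A. two_cohesive A \<longrightarrow> d \<le> degree_of A"
  have "\<exists>D. d = degree_of D"
    by transfer (auto simp: turing_equivalent_def intro: turing_reducible_refl)
  then obtain D where d: "d = degree_of D" ..
  show "d \<le> zero_jump"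
  proof (rule ccontr)
    assume "\<not> d \<le> zero_jump"
    then have "\<not> turing_reducible D halting_set" unfolding d zero_jump_def degree_of_le_iff .
    \<comment> \<open>By Post's theorem not both \<open>D\<close> and its complement are c.e. in the
      halting set; any set that computes \<open>D\<close> computes both.\<close>
    then obtain E where E: "E = D \<or> E = - D" "\<not> ce_in halting_set E"
      using reducible_if_ce_in_both by blast
    from ex_two_cohesive_avoids[OF E(2)]
    obtain A where A: "two_cohesive A" "\<not> ce_in (join halting_set A) E" by (elim exE conjE)
    with below have "turing_reducible D A" unfolding d degree_of_le_iff by blast
    then have "turing_reducible E A" using E(1) reducible_Compl by blast
    then have "ce_in (join halting_set A) E"
      by (intro ce_in_reducible turing_reducible_trans[OF _ reducible_join2])
    with A(2) show False ..
  qed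
next
  assume d: "d \<le> zero_jump"
  show "\<forall>A. two_cohesive A \<longrightarrow> d \<le> degree_of A"
  proof (intro allI impI)
    fix A assume "two_cohesive A"
    then have "zero_jump \<le> degree_of A"
      unfolding zero_jump_def degree_of_le_iff by (rule halting_set_reducible_if_two_cohesive)
    with d show "d \<le> degree_of A" by (rule order_trans)
  qed
qed

end
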